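(* Let $0<p<q<\infty$ and let $\mathcal F$ be a family of pairs $(f,g)$ of non-negative measurable functions on $\mathbb{R}^n$. Suppose that for all weights $w$ with $w^p\in RH_{\frac qp}$, $$\|f\|_{L^q(w^q)}\lesssim\|g\|_{L^p(w^p)},\qquad (f,g)\in\mathcal F.$$ Then for all $p(\cdot)\in\mathcal P_0$ such that $p<p_-\le p_+<\frac{1}{\frac1p-\frac1q}$ and $p(\cdot)\in LH$, $$\|f\|_{L^{q(\cdot)}}\lesssim\|g\|_{L^{p(\cdot)}},\qquad (f,g)\in\mathcal F,$$ where $q(\cdot)$ is defined by $\frac1{p(\cdot)}-\frac1{q(\cdot)}=\frac1p-\frac1q$.
   Context: Convention for inequalities over $\mathcal F$: an inequality $\|f\|_X\lesssim\|g\|_Y$, $(f,g)\in\mathcal F$, means that there is a constant $C$, independent of the pair, such that $\|f\|_X\le C\|g\|_Y$ for every $(f,g)\in\mathcal F$ with $\|f\|_X<\infty$. In the weighted hypothesis the constant depends on the weight $w$ only through the constant of the weight class, $[w^p]_{RH_{q/p}}$, and not on $w$ itself. Weights: a weight is a non-negative locally integrable function $w$ with $0<w<\infty$ a.e. For $1<s<\infty$, $v\in RH_s$ if there is $C$ with $\left(\frac1{|Q|}\int_Q v^s\,dx\right)^{1/s}\le C\,\frac1{|Q|}\int_Q v\,dx$ for every cube $Q$ (sides parallel to the axes); the least such $C$ is $[v]_{RH_s}$. $\|f\|_{L^p(v)}=\left(\int_{\mathbb{R}^n}|f|^pv\,dx\right)^{1/p}$. Variable Lebesgue spaces: $\mathcal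 P_0$ is the set of measurable functions $p(\cdot):\mathbb{R}^n\to(0,\infty)$; $p_-=\operatorname{ess\,inf}_{x}p(x)$, $p_+=\operatorname{ess\,sup}_{x}p(x)$. $p(\cdot)\in LH$ means there are constants $C_0,C_\infty,p_\infty$ with $|p(x)-p(y)|\le\frac{C_0}{-\log(|x-y|)}$ for $|x-y|<\frac12$ and $|p(x)-p_\infty|\le\frac{C_\infty}{\log(e+|x|)}$ for all $x$. $\|f\|_{L^{p(\cdot)}}=\inf\left\{\lambda>0:\int_{\mathbb{R}^n}\left(\frac{|f(x)|}{\lambda}\right)^{p(x)}dx\le1\right\}$. *)

theory Defs
  imports "HOL-Probability.Essential_Supremum"
begin

text \<open>
  Euclidean space is an arbitrary type of class \<open>euclidean_space\<close>, measurability and integration are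
  with respect to \<open>lebesgue\<close>, and non-negative functions (including weights) are functions
  into \<open>ennreal\<close>, so that norms may be infinite.
\<close>

text \<open>Powers on $[0,\infty]$ with $\infty^a = \infty$ and $0^a = 0$; only exponents $a > 0$ are relevant.\<close>

definition epowr :: "ennreal \<Rightarrow> real \<Rightarrow> ennreal" where
  "epowr x a = (if x = \<infinity> then \<infinity> else ennreal (enn2real x powr a))"

definition cube :: "'a::euclidean_space set \<Rightarrow> bool" where
  "cube Q \<longleftrightarrow> (\<exists>a l. 0 < l \<and> Q = cbox a (a + l *\<^sub>R One))"

definition avg :: "'a::euclidean_space set \<Rightarrow> ('a \<Rightarrow> ennreal) \<Rightarrow> ennreal" where
  "avg Q v = (\<integral>\<^sup>+ x\<in>Q. v x \<partial>lebesgue) / emeasure lebesgue Q"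

definition weight :: "('a::euclidean_space \<Rightarrow> ennreal) \<Rightarrow> bool" where
  "weight w \<longleftrightarrow> w \<in> borel_measurable lebesgue
     \<and> (\<forall>K. compact K \<longrightarrow> (\<integral>\<^sup>+ x\<in>K. w x \<partial>lebesgue) < \<infinity>)
     \<and> (AE x in lebesgue. 0 < w x \<and> w x < \<infinity>)"

definition RH_bound :: "real \<Rightarrow> ('a::euclidean_space \<Rightarrow> ennreal) \<Rightarrow> real \<Rightarrow> bool" where
  "RH_bound s v C \<longleftrightarrow> 0 \<le> C \<and>
     (\<forall>Q. cube Q \<longrightarrow> epowr (avg Q (\<lambda>x. epowr (v x) s)) (1 / s) \<le> ennreal C * avg Q v)"

definition RH :: "real \<Rightarrow> ('a::euclidean_space \<Rightarrow> ennreal) set" where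
  "RH s = {v. weight v \<and> (\<exists>C. RH_bound s v C)}"

definition RH_const :: "real \<Rightarrow> ('a::euclidean_space \<Rightarrow> ennreal) \<Rightarrow> real" where
  "RH_const s v = Inf {C. RH_bound s v C}"

definition Lp_norm :: "real \<Rightarrow> ('a::euclidean_space \<Rightarrow> ennreal) \<Rightarrow> ('a \<Rightarrow> ennreal) \<Rightarrow> ennreal" where
  "Lp_norm p v f = epowr (\<integral>\<^sup>+ x. epowr (f x) p * v x \<partial>lebesgue) (1 / p)"

definition P0 :: "('a::euclidean_space \<Rightarrow> real) set" where
  "P0 = {p. p \<in> borel_measurable lebesgue \<and> (\<forall>x. 0 < p x)}"

definition exp_minus :: "('a::euclidean_space \<Rightarrow> real) \<Rightarrow> ereal" where
  "exp_minus p = Sup {z. AE x in lebesgue. z \<le> ereal (p x)}"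

definition exp_plus :: "('a::euclidean_space \<Rightarrow> real) \<Rightarrow> ereal" where
  "exp_plus p = esssup lebesgue (\<lambda>x. ereal (p x))"

text \<open>For $x = y$ the first condition is trivially true, because \<open>ln 0 = 0\<close> and \<open>C0 / 0 = 0\<close>.\<close>

definition LH :: "('a::euclidean_space \<Rightarrow> real) set" where
  "LH = {p. \<exists>C0 Cinf pinf::real.
     (\<forall>x y. norm (x - y) < 1 / 2 \<longrightarrow> \<bar>p x - p y\<bar> \<le> C0 / (- ln (norm (x - y))))
     \<and> (\<forall>x. \<bar>p x - pinf\<bar> \<le> Cinf / ln (exp 1 + norm x))}"

text \<open>The infimum of the empty set is $\infty$.\<close>

definition var_norm :: "('a::euclidean_space \<Rightarrow> real) \<Rightarrow> ('a \<Rightarrow> ennreal) \<Rightarrow> ennreal" where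
  "var_norm p f =
     Inf (ennreal ` {l. 0 < l \<and> (\<integral>\<^sup>+ x. epowr (f x / ennreal l) (p x) \<partial>lebesgue) \<le> 1})"

text \<open>The inequality \<open>N f \<le> C * M g\<close> over a family of pairs is only claimed where
  the left-hand side is finite.\<close>

definition family_ineq ::
  "('a \<Rightarrow> ennreal) \<Rightarrow> ('a \<Rightarrow> ennreal) \<Rightarrow> real \<Rightarrow> ('a \<times> 'a) set \<Rightarrow> bool" where
  "family_ineq N M C F \<longleftrightarrow> (\<forall>(f, g)\<in>F. N f < \<infinity> \<longrightarrow> N f \<le> ennreal C * M g)"

end

theory Submission
  imports Defs
begin

text \<open>
  The idea is duality combined with the algorithm of Rubio de Francia. Let \<open>r\<close> be the exponent
  conjugate to \<open>qv / q\<close>. The norm of \<open>f\<close> in $L^{q(\cdot)}$ is recovered from the integral of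
  \<open>f^q * h\<close> for a suitable \<open>h\<close> in the unit ball of $L^{r(\cdot)}$ (\<open>dual_function\<close>). Such an \<open>h\<close> has a
  majorant \<open>H\<close> of comparable size in the class $A_1$, with a uniform $A_1$ constant (\<open>A1_majorant\<close>). For the
  weight \<open>w = H^(1/q)\<close> the $A_1$ condition gives \<open>w^p \<in> RH (q / p)\<close> at once, so that the hypothesis
  bounds the integral of \<open>f^q * H\<close> by a power of the integral of \<open>g^p * H^(p/q)\<close>. The relation
  between the exponents says exactly that the exponent conjugate to \<open>pv / p\<close> is \<open>r * q / p\<close>;
  hence the last integral is controlled by the norm of \<open>g\<close> in $L^{p(\cdot)}$ and the modular of
  \<open>H\<close> for \<open>r\<close> (\<open>extrapolation\<close>). The bounds for \<open>pv\<close> are what makes \<open>r\<close> bounded and bounded away from one.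

  The majorant is a geometric series of iterates of the maximal operator, so the maximal operator
  has to be bounded for the exponent \<open>r\<close> (\<open>maximal_modular\<close>). This follows from the case of a constant
  exponent (\<open>maximal_strong_type\<close>) and a pointwise comparison (\<open>maximal_pointwise\<close>) in which
  log-Hoelder continuity allows the exponent to change: locally at points of one cube, and near infinity
  towards the limit of \<open>r\<close>, at the price of an integrable tail.

  Two points need care. The weight \<open>w\<close> has to be locally integrable, which can fail for
  \<open>H^(1/q)\<close> if \<open>q < 1\<close>; so \<open>h\<close> is truncated, and \<open>H\<close> inherits the bound. And the constant of
  the weighted inequality is an arbitrary, possibly wildly unbounded, function of the reverse
  Hoelder constant, so an upper bound for the latter is useless. Therefore \<open>w^p\<close> is
  perturbed: adding a spike of variable height changes its reverse Hoelder constant continuously, from an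
  amount bounded in terms of the $A_1$ constant to a larger prescribed value. At some height the
  constant equals that value exactly, while the weight stays uniformly comparable to the original one
  (\<open>A1_comparable_RH_const_eq\<close>).
\<close>

section \<open>Powers of extended non-negative reals\<close>

lemma epowr_ennreal [simp]: "0 \<le> x \<Longrightarrow> epowr (ennreal x) a = ennreal (x powr a)"
  by (simp add: epowr_def)

lemma epowr_top [simp]: "epowr \<infinity> a = \<infinity>" "epowr top a = top"
  by (simp_all add: epowr_def)

lemma epowr_zero [simp]: "epowr 0 a = 0"
  by (simp add: epowr_def)

lemma epowr_one [simp]: "epowr 1 a = 1"
  using epowr_ennreal[of 1 a] by simp

lemma epowr_1 [simp]: "epowr x 1 = x"
  by (cases x) (auto simp: epowr_def)

lemma epowr_mono: "0 < a \<Longrightarrow> x \<le> y \<Longrightarrow> epowr x a \<le> epowr y a"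
  by (cases x; cases y) (auto simp: epowr_def top_unique intro!: powr_mono2 ennreal_leI)

lemma epowr_mult: "0 < a \<Longrightarrow> epowr (x * y) a = epowr x a * epowr y a"
proof (cases x; cases y)
  fix r s assume *: "x = ennreal r" "y = ennreal s" "0 \<le> r" "0 \<le> s"
  then show "epowr (x * y) a = epowr x a * epowr y a"
    by (simp add: ennreal_mult' [symmetric] powr_mult)
qed (auto simp: ennreal_mult_eq_top_iff ennreal_top_mult ennreal_mult_top epowr_def
        split: if_splits)

lemma epowr_epowr: "epowr (epowr x a) b = epowr x (a * b)"
  by (cases x) (auto simp: epowr_def powr_powr)

lemma epowr_add: "epowr x a * epowr x b = epowr x (a + b)"
  by (cases x) (auto simp: epowr_def powr_add ennreal_mult)

lemma epowr_inverse [simp]: "a \<noteq> 0 \<Longrightarrow> epowr (epowr x a) (1 / a) = x"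
  "a \<noteq> 0 \<Longrightarrow> epowr (epowr x (1 / a)) a = x"
  by (simp_all add: epowr_epowr)

lemma epowr_le_iff: "0 < a \<Longrightarrow> epowr x a \<le> epowr y a \<longleftrightarrow> x \<le> y"
  using epowr_mono[of a x y] epowr_mono[of "1 / a" "epowr x a" "epowr y a"] by auto

lemma epowr_le_iff_le_epowr: "0 < a \<Longrightarrow> epowr x a \<le> y \<longleftrightarrow> x \<le> epowr y (1 / a)"
  using epowr_le_iff[of a x "epowr y (1 / a)"] by simp

lemma epowr_eq_0_iff [simp]: "epowr x a = 0 \<longleftrightarrow> x = 0"
  by (cases x) (auto simp: epowr_def)

lemma epowr_eq_top_iff [simp]: "epowr x a = top \<longleftrightarrow> x = top"
  by (cases x) (auto simp: epowr_def)

lemma epowr_less_top_iff [simp]: "epowr x a < top \<longleftrightarrow> x < top"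
  using epowr_eq_top_iff[of x a] by (auto simp: less_top simp del: epowr_eq_top_iff)

lemma measurable_epowr [measurable (raw)]:
  assumes [measurable]: "f \<in> borel_measurable M" "a \<in> borel_measurable M"
  shows "(\<lambda>x. epowr (f x) (a x)) \<in> borel_measurable M"
  unfolding epowr_def by measurable

lemma epowr_add_le:
  assumes "0 < a"
  shows "epowr (x + y) a \<le> ennreal (2 powr a) * (epowr x a + epowr y a)"
proof -
  have "x + y \<le> ennreal 2 * max x y"
    using add_mono[of x "max x y" y "max x y"] by (simp add: mult_2)
  then have "epowr (x + y) a \<le> epowr (ennreal 2 * max x y) a"
    using assms epowr_mono by blast
  also have "\<dots> = ennreal (2 powr a) * epowr (max x y) a"
    using assms epowr_ennreal[of 2 a] by (simp add: epowr_mult)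
  also have "\<dots> \<le> ennreal (2 powr a) * (epowr x a + epowr y a)"
    by (intro mult_left_mono) (auto simp: max_def)
  finally show ?thesis .
qed

lemma epowr_exponent_mono:
  assumes "1 \<le> x" "a \<le> b"
  shows "epowr x a \<le> epowr x b"
proof (cases x)
  case (real r)
  then have "1 \<le> r" using assms by (simp add: ennreal_1[symmetric] del: ennreal_1)
  then show ?thesis using real assms by (auto intro!: ennreal_leI powr_mono)
qed auto

lemma epowr_exponent_antimono:
  assumes "x \<le> 1" "0 < a" "a \<le> b"
  shows "epowr x b \<le> epowr x a"
proof (cases x)
  case (real r)
  then have "r \<le> 1" using assms by (simp add: ennreal_1[symmetric] del: ennreal_1)
  then show ?thesis using real assms by (auto intro!: ennreal_leI powr_mono')
qed (use assms in auto)

text \<open>Below the threshold \<open>T\<close> the first summand dominates and above it the second one does.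
  Averaging this and choosing \<open>T\<close> well gives Jensen's and Hoelder's inequality up to a factor
  of two, also when the exponent varies with the point.\<close>

lemma le_threshold:
  assumes "0 < T" "1 \<le> s"
  shows "u \<le> ennreal T + ennreal (T powr (1 - s)) * epowr u s"
proof (cases u)
  case (real y)
  show ?thesis
  proof (cases "y \<le> T")
    case True
    then show ?thesis using real by (auto intro: ennreal_leI add_increasing2)
  next
    case False
    then have "y = y powr (1 - s) * y powr s"
      using assms by (simp add: powr_add[symmetric])
    also have "\<dots> \<le> T powr (1 - s) * y powr s"
      using False assms by (intro mult_right_mono powr_mono2') auto
    finally have "ennreal y \<le> ennreal (T powr (1 - s)) * epowr u s"
      using real by (simp add: ennreal_mult'[symmetric] ennreal_leI)
    then show ?thesis using real by (auto intro: add_increasing)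
  qed
next
  case top
  then show ?thesis using assms by (simp add: ennreal_mult_top)
qed

text \<open>Young's inequality without the optimal constants: one of the two factors is at most the
  corresponding power of the other.\<close>

lemma mult_le_epowr_conjugate:
  assumes "1 < s" "1 / s + 1 / t = 1"
  shows "x * y \<le> epowr x s + epowr y t"
proof -
  have t: "0 < t"
    using assms by (smt (verit) divide_less_eq_1_pos zero_less_divide_1_iff)
  have st: "1 + s / t = s"  "1 + t / s = t"
    using assms t by (auto simp: field_simps)
  show ?thesis
  proof (cases "x = top \<or> y = top")
    case True
    then show ?thesis by auto
  next
    case False
    show ?thesis
    proof (cases "y \<le> epowr x (s / t)")
      case True
      then have "x * y \<le> epowr x 1 * epowr x (s / t)"
        by (simp add: mult_left_mono)
      also have "\<dots> = epowr x s"
        by (simp only: epowr_add st)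
      finally show ?thesis by (rule add_increasing2[rotated]) simp
    next
      case F: False
      then have "epowr x (s / t) \<le> y" by simp
      then have "x \<le> epowr y (t / s)"
        using epowr_le_iff_le_epowr[of "s / t" x y] assms t by simp
      then have "x * y \<le> epowr y 1 * epowr y (t / s)"
        by (subst mult.commute) (simp add: mult_left_mono)
      also have "\<dots> = epowr y t"
        by (simp only: epowr_add st)
      finally show ?thesis by (rule add_increasing[rotated]) simp
    qed
  qed
qed

section \<open>Cubes and averages\<close>

abbreviation cube_at :: "'a::euclidean_space \<Rightarrow> real \<Rightarrow> 'a set" where
  "cube_at a l \<equiv> cbox a (a + l *\<^sub>R One)"

abbreviation open_cube_at :: "'a::euclidean_space \<Rightarrow> real \<Rightarrow> 'a set" where
  "open_cube_at a l \<equiv> box a (a + l *\<^sub>R One)"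

lemma emeasure_cube_at:
  "0 < l \<Longrightarrow> emeasure lebesgue (cube_at (a::'a::euclidean_space) l) = ennreal (l ^ DIM('a))"
  by (simp add: emeasure_lborel_cbox_eq inner_add_left inner_diff_left)

lemma emeasure_cube_at_pos_finite:
  assumes "0 < l"
  shows "emeasure lebesgue (cube_at (a::'a::euclidean_space) l) \<noteq> 0"
    "emeasure lebesgue (cube_at (a::'a::euclidean_space) l) \<noteq> top"
  unfolding emeasure_cube_at[OF assms] using assms by auto

lemma AE_cube_at_open_cube_at:
  "AE x in lebesgue. x \<in> cube_at (a::'a::euclidean_space) l \<longrightarrow> x \<in> open_cube_at a l"
proof -
  have "cube_at a l - open_cube_at a l \<in> null_sets lebesgue"
    using negligible_frontier_interval[of a "a + l *\<^sub>R One"] by (simp add: negligible_iff_null_sets)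
  then show ?thesis
    by (rule AE_I') auto
qed

lemma avg_mono_AE:
  "AE x in lebesgue. x \<in> Q \<longrightarrow> f x \<le> g x \<Longrightarrow> avg Q f \<le> avg Q g"
  unfolding avg_def by (intro divide_right_mono_ennreal nn_integral_mono_AE)
    (auto simp: indicator_def elim!: eventually_mono)

lemma avg_mono: "(\<And>x. x \<in> Q \<Longrightarrow> f x \<le> g x) \<Longrightarrow> avg Q f \<le> avg Q g"
  by (intro avg_mono_AE AE_I2) auto

lemma avg_mono_open_cube:
  "(\<And>x. x \<in> open_cube_at a l \<Longrightarrow> f x \<le> g x) \<Longrightarrow> avg (cube_at a l) f \<le> avg (cube_at a l) g"
  using AE_cube_at_open_cube_at[of a l] by (intro avg_mono_AE) (auto elim!: eventually_mono)

lemma avg_add: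
  assumes "f \<in> borel_measurable lebesgue" "g \<in> borel_measurable lebesgue" "Q \<in> sets lebesgue"
  shows "avg Q (\<lambda>x. f x + g x) = avg Q f + avg Q g"
proof -
  have "(\<integral>\<^sup>+x\<in>Q. (f x + g x) \<partial>lebesgue) = (\<integral>\<^sup>+x\<in>Q. f x \<partial>lebesgue) + (\<integral>\<^sup>+x\<in>Q. g x \<partial>lebesgue)"
    using assms by (subst nn_integral_add[symmetric]) (auto simp: distrib_right)
  then show ?thesis
    by (simp add: avg_def add_divide_distrib_ennreal)
qed

lemma avg_cmult:
  assumes "f \<in> borel_measurable lebesgue" "Q \<in> sets lebesgue"
  shows "avg Q (\<lambda>x. c * f x) = c * avg Q f"
proof -
  have "(\<integral>\<^sup>+x\<in>Q. (c * f x) \<partial>lebesgue) = c * (\<integral>\<^sup>+x\<in>Q. f x \<partial>lebesgue)"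
    using assms by (subst nn_integral_cmult[symmetric]) (auto simp: mult.assoc)
  then show ?thesis
    by (simp add: avg_def ennreal_times_divide)
qed

lemma avg_suminf:
  assumes "\<And>i::nat. f i \<in> borel_measurable lebesgue" "Q \<in> sets lebesgue"
  shows "avg Q (\<lambda>x. \<Sum>i. f i x) = (\<Sum>i. avg Q (f i))"
proof -
  have "(\<integral>\<^sup>+x\<in>Q. (\<Sum>i. f i x) \<partial>lebesgue) = (\<Sum>i. \<integral>\<^sup>+x\<in>Q. f i x \<partial>lebesgue)"
    using assms by (subst nn_integral_suminf[symmetric]) auto
  then show ?thesis
    by (simp add: avg_def divide_ennreal_def)
qed

lemma avg_const:
  assumes "0 < l"
  shows "avg (cube_at (a::'a::euclidean_space) l) (\<lambda>x. c) = c"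
  using emeasure_cube_at_pos_finite[OF assms, of a] unfolding avg_def
  by (simp add: nn_integral_cmult_indicator ennreal_mult_divide_eq)

lemma nn_integral_cube_at_eq_avg:
  assumes "0 < l"
  shows "(\<integral>\<^sup>+x\<in>cube_at (a::'a::euclidean_space) l. f x \<partial>lebesgue)
    = avg (cube_at a l) f * ennreal (l ^ DIM('a))"
proof -
  have "ennreal (l ^ DIM('a)) / ennreal (l ^ DIM('a)) = 1"
    using emeasure_cube_at_pos_finite[OF assms, of a] unfolding emeasure_cube_at[OF assms]
    by (intro ennreal_divide_self) (auto simp: less_top)
  then show ?thesis unfolding avg_def emeasure_cube_at[OF assms]
    by (simp add: ennreal_divide_times)
qed

text \<open>Hoelder's inequality on a cube up to a factor of two.\<close>

lemma avg_le_epowr_avg: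
  fixes a :: "'a::euclidean_space"
  assumes [measurable]: "u \<in> borel_measurable lebesgue" and "1 \<le> s" "0 < l"
  shows "avg (cube_at a l) u \<le> 2 * epowr (avg (cube_at a l) (\<lambda>x. epowr (u x) s)) (1 / s)"
proof -
  let ?Q = "cube_at a l"
  define V where "V = avg ?Q (\<lambda>x. epowr (u x) s)"
  have le: "avg ?Q u \<le> ennreal T + ennreal (T powr (1 - s)) * V" if "0 < T" for T
  proof -
    have "avg ?Q u \<le> avg ?Q (\<lambda>x. ennreal T + ennreal (T powr (1 - s)) * epowr (u x) s)"
      by (intro avg_mono le_threshold that assms)
    also have "\<dots> = ennreal T + ennreal (T powr (1 - s)) * V"
      unfolding V_def using assms by (subst avg_add) (auto simp: avg_const avg_cmult)
    finally show ?thesis .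
  qed
  consider "V = top" | "V = 0" | v where "V = ennreal v" "0 < v"
    by (cases V) (auto simp: less_le)
  then have "avg ?Q u \<le> 2 * epowr V (1 / s)"
  proof cases
    case 1
    then show ?thesis by (simp add: ennreal_mult_top)
  next
    case 2
    have "avg ?Q u \<le> ennreal T" if "0 < T" for T
      using le[OF that] 2 by simp
    then have "avg ?Q u \<le> 0"
      by (metis add.left_neutral ennreal_le_epsilon zero_le)
    then show ?thesis by simp
  next
    case 3
    define T where "T = v powr (1 / s)"
    have "T powr (1 - s) * v = T"
    proof -
      have "v = T powr s" using 3 assms by (simp add: T_def powr_powr)
      then have "T powr (1 - s) * v = T powr (1 - s) * T powr s" by simp
      also have "\<dots> = T" using 3 by (simp add: powr_add[symmetric] T_def)
      finally show ?thesis .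
    qed
    then have "avg ?Q u \<le> ennreal T + ennreal T"
      using le[of T] 3 by (simp add: T_def ennreal_mult'[symmetric])
    then show ?thesis using 3 by (simp add: T_def mult_2)
  qed
  then show ?thesis by (simp only: V_def)
qed

section \<open>The maximal operator\<close>

text \<open>The supremum runs over the cubes containing the point in their interior, which makes the
  superlevel sets open without any argument about enlarging cubes.\<close>

definition maximal :: "('a::euclidean_space \<Rightarrow> ennreal) \<Rightarrow> 'a \<Rightarrow> ennreal" where
  "maximal h x = (SUP (a, l) \<in> {(a, l). 0 < l \<and> x \<in> open_cube_at a l}. avg (cube_at a l) h)"

lemma avg_le_maximal: "0 < l \<Longrightarrow> x \<in> open_cube_at a l \<Longrightarrow> avg (cube_at a l) h \<le> maximal h x"
  unfolding maximal_def by (rule SUP_upper2[of "(a, l)"]) auto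

lemma maximal_le:
  "(\<And>a l. 0 < l \<Longrightarrow> x \<in> open_cube_at a l \<Longrightarrow> avg (cube_at a l) h \<le> c) \<Longrightarrow> maximal h x \<le> c"
  unfolding maximal_def by (rule SUP_least) auto

lemma less_maximalE:
  assumes "t < maximal h x"
  obtains a l where "0 < l" "x \<in> open_cube_at a l" "t < avg (cube_at a l) h"
  using assms unfolding maximal_def less_SUP_iff by auto

lemma open_less_maximal: "open {x::'a::euclidean_space. t < maximal h x}"
proof -
  have "{x. t < maximal h x} = (\<Union>(a, l) \<in> {(a, l). 0 < l \<and> t < avg (cube_at a l) h}. open_cube_at a l)"
    by (auto elim!: less_maximalE intro: less_le_trans avg_le_maximal)
  then show ?thesis by (auto intro!: open_UN open_box)
qed

lemma measurable_maximal [measurable]: "maximal h \<in> borel_measurable lebesgue"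
proof -
  have "maximal h \<in> borel_measurable borel"
    using open_less_maximal[of _ h] by (intro borel_measurableI_greater) auto
  then show ?thesis
    by (simp add: measurable_completion)
qed

lemma maximal_mono: "(\<And>x. f x \<le> g x) \<Longrightarrow> maximal f x \<le> maximal g x"
  by (intro maximal_le order.trans[OF avg_mono avg_le_maximal]) auto

lemma maximal_add_le:
  assumes [measurable]: "f \<in> borel_measurable lebesgue" "g \<in> borel_measurable lebesgue"
  shows "maximal (\<lambda>x. f x + g x) x \<le> maximal f x + maximal g x"
  by (rule maximal_le) (auto simp: avg_add intro!: add_mono avg_le_maximal)

lemma maximal_const_le: "maximal (\<lambda>x. c) x \<le> c"
  by (rule maximal_le) (simp add: avg_const)

lemma maximal_cmult_le:
  assumes [measurable]: "f \<in> borel_measurable lebesgue"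
  shows "maximal (\<lambda>x. c * f x) x \<le> c * maximal f x"
  by (rule maximal_le) (auto simp: avg_cmult intro!: mult_left_mono avg_le_maximal)

lemma maximal_suminf_le:
  assumes [measurable]: "\<And>i::nat. f i \<in> borel_measurable lebesgue"
  shows "maximal (\<lambda>x. \<Sum>i. f i x) x \<le> (\<Sum>i. maximal (f i) x)"
  by (rule maximal_le) (auto simp: avg_suminf intro!: suminf_le avg_le_maximal)

text \<open>Countably many cubes around a given point exhaust the space. If all of them had average zero,
  \<open>h\<close> would vanish almost everywhere.\<close>

lemma maximal_pos:
  fixes h :: "'a::euclidean_space \<Rightarrow> ennreal"
  assumes [measurable]: "h \<in> borel_measurable lebesgue" and "\<not> (AE x in lebesgue. h x = 0)"
  shows "0 < maximal h x"
proof (rule ccontr)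
  assume "\<not> 0 < maximal h x"
  then have *: "maximal h x = 0" by simp
  define Q where "Q i = cube_at (x - (real (Suc i)) *\<^sub>R One) (2 * real (Suc i))" for i
  have "AE y in lebesgue. y \<in> Q i \<longrightarrow> h y = 0" for i
  proof -
    have "x \<in> open_cube_at (x - (real (Suc i)) *\<^sub>R One) (2 * real (Suc i))"
      by (auto simp: mem_box inner_diff_left inner_add_left)
    then have "avg (Q i) h = 0"
      using avg_le_maximal[of "2 * real (Suc i)" x "x - (real (Suc i)) *\<^sub>R One" h] *
      by (simp add: Q_def)
    then have "(\<integral>\<^sup>+y\<in>Q i. h y \<partial>lebesgue) = 0"
      unfolding Q_def by (subst nn_integral_cube_at_eq_avg) auto
    moreover have [measurable]: "Q i \<in> sets lebesgue" by (simp add: Q_def)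
    ultimately have "AE y in lebesgue. h y * indicator (Q i) y = 0"
      by (subst (asm) nn_integral_0_iff_AE) measurable
    then show ?thesis by (rule eventually_mono) (auto simp: indicator_def)
  qed
  then have "AE y in lebesgue. \<forall>i. y \<in> Q i \<longrightarrow> h y = 0"
    by (subst AE_all_countable) auto
  moreover have "\<exists>i. y \<in> Q i" for y
  proof -
    obtain i where i: "norm (y - x) \<le> real i" using real_arch_simple by blast
    have "y \<in> Q i" unfolding Q_def mem_box
    proof (intro ballI)
      fix b :: 'a assume b: "b \<in> Basis"
      have "\<bar>(y - x) \<bullet> b\<bar> \<le> real i" using Basis_le_norm[OF b, of "y - x"] i by linarith
      then show "(x - real (Suc i) *\<^sub>R One) \<bullet> b \<le> y \<bullet> b \<and>
        y \<bullet> b \<le> (x - real (Suc i) *\<^sub>R One + (2 * real (Suc i)) *\<^sub>R One) \<bullet> b"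
        using b by (auto simp: inner_diff_left inner_add_left)
    qed
    then show ?thesis ..
  qed
  ultimately have "AE y in lebesgue. h y = 0"
    by (auto elim!: eventually_mono)
  with assms show False by simp
qed

lemma sigma_finite_lebesgue: "sigma_finite_measure (lebesgue :: 'a::euclidean_space measure)"
proof -
  obtain A :: "'a set set" where A: "countable A" "A \<subseteq> sets lborel" "\<Union>A = space lborel"
    "\<forall>a\<in>A. emeasure lborel a \<noteq> \<infinity>"
    using sigma_finite_lborel unfolding sigma_finite_measure_def by blast
  show ?thesis
    unfolding sigma_finite_measure_def
    using A by (intro exI[of _ A]) (auto intro: sets_completionI_sets)
qed

lemma sets_less_maximal: "{x::'a::euclidean_space. t < maximal h x} \<in> sets lebesgue"
  using open_less_maximal[of t h] by (intro sets_completionI_sets) simp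

definition weak_const :: "'a::euclidean_space itself \<Rightarrow> real" where
  "weak_const _ = (10 * real DIM('a)) ^ DIM('a)"

lemma weak_const_pos: "0 < weak_const TYPE('a::euclidean_space)"
  by (simp add: weak_const_def)

text \<open>The weak type $(1,1)$ inequality. A cube of side \<open>l\<close> lies in a ball of radius \<open>DIM('a) * l\<close>,
  whose fivefold enlargement lies in a cube of side \<open>10 * DIM('a) * l\<close>; so Vitali's covering lemma
  for balls selects disjoint cubes that carry a fixed fraction of the measure.\<close>

lemma emeasure_less_maximal_le:
  fixes k :: "'a::euclidean_space \<Rightarrow> ennreal"
  assumes [measurable]: "k \<in> borel_measurable lebesgue" and "0 < t"
  shows "emeasure lebesgue {x. ennreal t < maximal k x}
    \<le> ennreal (weak_const TYPE('a) / t) * (\<integral>\<^sup>+x. k x \<partial>lebesgue)"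
proof (cases "(\<integral>\<^sup>+x. k x \<partial>lebesgue)")
  case top
  then show ?thesis using assms weak_const_pos[where 'a='a] by (simp add: ennreal_mult_top)
next
  case (real I)
  let ?n = "real DIM('a)"
  define K where "K = {(a::'a, l). 0 < l \<and> ennreal t < avg (cube_at a l) k}"
  have vol: "ennreal (l ^ DIM('a)) \<le> ennreal (1 / t) * (\<integral>\<^sup>+x\<in>cube_at a l. k x \<partial>lebesgue)"
    if "(a, l) \<in> K" for a l
  proof -
    have "ennreal t * ennreal (l ^ DIM('a)) \<le> (\<integral>\<^sup>+x\<in>cube_at a l. k x \<partial>lebesgue)"
      using that by (subst nn_integral_cube_at_eq_avg) (auto simp: K_def intro: mult_right_mono)
    then have "ennreal (1 / t) * (ennreal t * ennreal (l ^ DIM('a)))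
        \<le> ennreal (1 / t) * (\<integral>\<^sup>+x\<in>cube_at a l. k x \<partial>lebesgue)"
      by (rule mult_left_mono) simp
    then show ?thesis
      using assms by (simp add: mult.assoc[symmetric] ennreal_mult'[symmetric])
  qed
  define B where "B = max 1 (I / t)"
  have side: "0 < l \<and> l \<le> B" if "(a, l) \<in> K" for a l
  proof -
    have l: "0 < l" using that by (simp add: K_def)
    have "(\<integral>\<^sup>+x\<in>cube_at a l. k x \<partial>lebesgue) \<le> ennreal I"
      unfolding real(2)[symmetric] by (intro nn_integral_mono) (auto simp: indicator_def)
    then have "ennreal (l ^ DIM('a)) \<le> ennreal (1 / t) * ennreal I"
      by (intro order.trans[OF vol[OF that]] mult_left_mono) auto
    then have "l ^ DIM('a) \<le> I / t"
      using assms real by (simp add: ennreal_mult'[symmetric] ennreal_le_iff)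
    moreover have "l \<le> l ^ DIM('a)" if "1 \<le> l"
      using power_increasing[of 1 "DIM('a)" l] that by (simp add: Suc_leI)
    ultimately show ?thesis using l by (cases "1 \<le> l") (auto simp: B_def)
  qed
  have in_ball: "cube_at a l \<subseteq> cball a (?n * l)" if "0 < l" for a :: 'a and l
  proof
    fix y assume y: "y \<in> cube_at a l"
    have "norm (y - a) \<le> (\<Sum>b\<in>Basis. \<bar>(y - a) \<bullet> b\<bar>)" by (rule norm_le_l1)
    also have "\<dots> \<le> (\<Sum>b\<in>(Basis::'a set). l)"
      using y that by (intro sum_mono) (auto simp: mem_box inner_diff_left inner_add_left abs_le_iff)
    finally show "y \<in> cball a (?n * l)" by (simp add: dist_norm norm_minus_commute)
  qed
  have cov: "{x. ennreal t < maximal k x} \<subseteq> (\<Union>i\<in>K. cball (fst i) (?n * snd i))"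
  proof
    fix x assume "x \<in> {x. ennreal t < maximal k x}"
    then obtain a l where "0 < l" "x \<in> open_cube_at a l" "ennreal t < avg (cube_at a l) k"
      by (auto elim: less_maximalE)
    then show "x \<in> (\<Union>i\<in>K. cball (fst i) (?n * snd i))"
      using in_ball[of l a] box_subset_cbox[of a "a + l *\<^sub>R One"]
      by (intro UN_I[of "(a, l)"]) (auto simp: K_def)
  qed
  have rad: "0 < ?n * snd i \<and> ?n * snd i \<le> ?n * B" if "i \<in> K" for i
    using side[of "fst i" "snd i"] that by (auto intro: mult_left_mono)
  obtain C where C: "countable C" "C \<subseteq> K"
     "pairwise (\<lambda>i j. disjnt (cball (fst i) (?n * snd i)) (cball (fst j) (?n * snd j))) C"
     "{x. ennreal t < maximal k x} \<subseteq> (\<Union>i\<in>C. cball (fst i) (5 * (?n * snd i)))"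
    using Vitali_covering_lemma_cballs[OF cov rad] by blast
  let ?Q = "\<lambda>i. cube_at (fst i) (snd i)"
  have big: "emeasure lebesgue (cball (fst i) (5 * (?n * snd i)))
      \<le> ennreal (weak_const TYPE('a) / t) * (\<integral>\<^sup>+x\<in>?Q i. k x \<partial>lebesgue)" if "i \<in> C" for i
  proof -
    obtain a l where i: "i = (a, l)" by force
    with that C have K: "(a, l) \<in> K" and l: "0 < l" by (auto simp: K_def)
    have "cball a (5 * (?n * l)) \<subseteq> cube_at (a - (5 * (?n * l)) *\<^sub>R One) (10 * ?n * l)"
    proof
      fix y assume "y \<in> cball a (5 * (?n * l))"
      then have y: "norm (y - a) \<le> 5 * (?n * l)" by (simp add: dist_norm norm_minus_commute)
      show "y \<in> cube_at (a - (5 * (?n * l)) *\<^sub>R One) (10 * ?n * l)"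
        unfolding mem_box
      proof (intro ballI)
        fix b :: 'a assume b: "b \<in> Basis"
        have "\<bar>(y - a) \<bullet> b\<bar> \<le> 5 * (?n * l)" using Basis_le_norm[OF b, of "y - a"] y by linarith
        then show "(a - (5 * (?n * l)) *\<^sub>R One) \<bullet> b \<le> y \<bullet> b \<and>
          y \<bullet> b \<le> (a - (5 * (?n * l)) *\<^sub>R One + (10 * ?n * l) *\<^sub>R One) \<bullet> b"
          using b by (auto simp: inner_diff_left inner_add_left abs_le_iff algebra_simps)
      qed
    qed
    then have "emeasure lebesgue (cball a (5 * (?n * l)))
        \<le> emeasure lebesgue (cube_at (a - (5 * (?n * l)) *\<^sub>R One) (10 * ?n * l))"
      by (intro emeasure_mono) auto
    also have "\<dots> = ennreal ((10 * ?n * l) ^ DIM('a))"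
      using l by (intro emeasure_cube_at) simp
    also have "\<dots> = ennreal (weak_const TYPE('a)) * ennreal (l ^ DIM('a))"
      using l by (simp add: weak_const_def power_mult_distrib ennreal_mult'[symmetric])
    also have "\<dots> \<le> ennreal (weak_const TYPE('a)) * (ennreal (1 / t) * (\<integral>\<^sup>+x\<in>cube_at a l. k x \<partial>lebesgue))"
      by (intro mult_left_mono vol K) auto
    also have "\<dots> = ennreal (weak_const TYPE('a) / t) * (\<integral>\<^sup>+x\<in>cube_at a l. k x \<partial>lebesgue)"
      using assms weak_const_pos[where 'a='a] by (simp add: mult.assoc[symmetric] ennreal_mult'[symmetric])
    finally show ?thesis by (simp add: i)
  qed
  have [measurable]: "{x. ennreal t < maximal k x} \<in> sets lebesgue"
    by (rule sets_less_maximal)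
  have "emeasure lebesgue {x. ennreal t < maximal k x}
      = (\<integral>\<^sup>+x. indicator {x. ennreal t < maximal k x} x \<partial>lebesgue)"
    by simp
  also have "\<dots> \<le> (\<integral>\<^sup>+x. \<integral>\<^sup>+i. indicator (cball (fst i) (5 * (?n * snd i))) x \<partial>count_space C \<partial>lebesgue)"
  proof (intro nn_integral_mono)
    fix x :: 'a
    show "(indicator {x. ennreal t < maximal k x} x :: ennreal)
      \<le> (\<integral>\<^sup>+i. indicator (cball (fst i) (5 * (?n * snd i))) x \<partial>count_space C)"
    proof (cases "x \<in> {x. ennreal t < maximal k x}")
      case True
      with C(4) obtain i where i: "i \<in> C" "x \<in> cball (fst i) (5 * (?n * snd i))" by blast
      have "(1::ennreal) = (\<integral>\<^sup>+j. indicator {i} j \<partial>count_space C)"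
        using i by (subst nn_integral_indicator) auto
      also have "\<dots> \<le> (\<integral>\<^sup>+i. indicator (cball (fst i) (5 * (?n * snd i))) x \<partial>count_space C)"
        using i by (intro nn_integral_mono) (auto simp: indicator_def)
      finally show ?thesis using True by simp
    qed simp
  qed
  also have "\<dots> = (\<integral>\<^sup>+i. \<integral>\<^sup>+x. indicator (cball (fst i) (5 * (?n * snd i))) x \<partial>lebesgue \<partial>count_space C)"
    using C(1) by (subst nn_integral_count_space_nn_integral)
      (auto intro!: borel_measurable_indicator sets_completionI_sets)
  also have "\<dots> \<le> (\<integral>\<^sup>+i. ennreal (weak_const TYPE('a) / t) * (\<integral>\<^sup>+x\<in>?Q i. k x \<partial>lebesgue) \<partial>count_space C)"
    using big by (intro nn_integral_mono) auto
  also have "\<dots> = ennreal (weak_const TYPE('a) / t) * (\<integral>\<^sup>+i. (\<integral>\<^sup>+x\<in>?Q i. k x \<partial>lebesgue) \<partial>count_space C)"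
    by (simp add: nn_integral_cmult)
  also have "(\<integral>\<^sup>+i. (\<integral>\<^sup>+x\<in>?Q i. k x \<partial>lebesgue) \<partial>count_space C)
      = (\<integral>\<^sup>+x. \<integral>\<^sup>+i. k x * indicator (?Q i) x \<partial>count_space C \<partial>lebesgue)"
    using C(1) by (subst nn_integral_count_space_nn_integral)
      (auto intro!: borel_measurable_times_ennreal borel_measurable_indicator assms(1))
  also have "\<dots> \<le> (\<integral>\<^sup>+x. k x \<partial>lebesgue)"
  proof (intro nn_integral_mono)
    fix x :: 'a
    show "(\<integral>\<^sup>+i. k x * indicator (?Q i) x \<partial>count_space C) \<le> k x"
    proof (cases "\<exists>i\<in>C. x \<in> ?Q i")
      case False
      then have "(\<integral>\<^sup>+i. k x * indicator (?Q i) x \<partial>count_space C) = 0"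
        by (subst nn_integral_cong[where v = "\<lambda>_. 0"]) auto
      then show ?thesis by simp
    next
      case True
      then obtain i where i: "i \<in> C" "x \<in> ?Q i" by blast
      have "indicator (?Q j) x \<le> (indicator {i} j :: ennreal)" if "j \<in> C" for j
      proof (cases "j = i \<or> x \<notin> ?Q j")
        case False
        then have x: "x \<in> ?Q j" by simp
        have "i \<in> K" "j \<in> K" using i that C(2) by blast+
        then have "0 < snd i" "0 < snd j"
          using side[of "fst i" "snd i"] side[of "fst j" "snd j"] by simp_all
        then have "x \<in> cball (fst i) (?n * snd i)" "x \<in> cball (fst j) (?n * snd j)"
          using subsetD[OF in_ball i(2)] subsetD[OF in_ball x] by blast+
        moreover have "disjnt (cball (fst i) (?n * snd i)) (cball (fst j) (?n * snd j))"
          using C(3) i that False by (auto simp: pairwise_def)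
        ultimately show ?thesis by (auto simp: disjnt_def)
      qed (auto simp: indicator_def)
      then have "(\<integral>\<^sup>+j. k x * indicator (?Q j) x \<partial>count_space C)
          \<le> (\<integral>\<^sup>+j. k x * indicator {i} j \<partial>count_space C)"
        by (intro nn_integral_mono mult_left_mono) auto
      also have "\<dots> = k x"
        using i by (subst nn_integral_cmult_indicator) auto
      finally show ?thesis .
    qed
  qed
  finally show ?thesis by (simp add: mult_left_mono)
qed

text \<open>The part of \<open>k\<close> below half the level contributes at most half the level to the maximal
  function, so the weak type inequality only sees the part above.\<close>

lemma emeasure_less_maximal_le_truncated:
  fixes k :: "'a::euclidean_space \<Rightarrow> ennreal"
  assumes [measurable]: "k \<in> borel_measurable lebesgue" and "0 < t"
  shows "emeasure lebesgue {x. ennreal t < maximal k x}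
    \<le> ennreal (2 * weak_const TYPE('a) / t)
      * (\<integral>\<^sup>+x. k x * indicator {x. ennreal t < 2 * k x} x \<partial>lebesgue)"
proof -
  define k1 where "k1 x = k x * indicator {x. ennreal t < 2 * k x} x" for x
  have [measurable]: "k1 \<in> borel_measurable lebesgue" unfolding k1_def by measurable
  have half: "ennreal t = ennreal (t / 2) + ennreal (t / 2)"
    using assms by (simp add: ennreal_plus[symmetric] del: ennreal_plus)
  have "k x \<le> k1 x + ennreal (t / 2)" for x
  proof (cases "ennreal t < 2 * k x")
    case False
    have "k x \<le> ennreal (t / 2)"
    proof (rule ccontr)
      assume "\<not> k x \<le> ennreal (t / 2)"
      then have "ennreal t < k x + k x"
        unfolding half by (intro add_strict_mono) auto
      with False show False by (simp add: mult_2)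
    qed
    then show ?thesis by (rule add_increasing[OF zero_le])
  qed (simp add: k1_def)
  then have "maximal k x \<le> maximal k1 x + ennreal (t / 2)" for x
    by (rule order.trans[OF maximal_mono order.trans[OF maximal_add_le]])
      (auto intro!: add_left_mono maximal_const_le)
  moreover have "ennreal (t / 2) < maximal k1 x"
    if "ennreal t < maximal k1 x + ennreal (t / 2)" for x
    using that unfolding half by (metis add_right_mono not_less)
  ultimately have sub: "{x. ennreal t < maximal k x} \<subseteq> {x. ennreal (t / 2) < maximal k1 x}"
    using less_le_trans by blast
  have "emeasure lebesgue {x. ennreal t < maximal k x}
      \<le> emeasure lebesgue {x. ennreal (t / 2) < maximal k1 x}"
    by (intro emeasure_mono sub sets_less_maximal)
  also have "\<dots> \<le> ennreal (weak_const TYPE('a) / (t / 2)) * (\<integral>\<^sup>+x. k1 x \<partial>lebesgue)"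
    using assms by (intro emeasure_less_maximal_le) auto
  finally show ?thesis by (simp add: k1_def mult.commute)
qed

lemma epowr_layer_cake:
  assumes "0 < a"
  shows "(\<integral>\<^sup>+t. ennreal (a * t powr (a - 1)) * indicator {t. 0 < t \<and> ennreal t < u} t \<partial>lborel)
    = epowr u a"
proof -
  have fin: "(\<integral>\<^sup>+t. ennreal (a * t powr (a - 1)) * indicator {t. 0 < t \<and> ennreal t < ennreal r} t \<partial>lborel)
      = ennreal (r powr a)" if "0 \<le> r" for r
  proof -
    have "((\<lambda>t. a * t powr (a - 1)) has_integral (a * (r powr (a - 1 + 1) / (a - 1 + 1)))) {0..r}"
      using assms that by (intro has_integral_mult_right has_integral_powr_from_0) auto
    then have "((\<lambda>t. a * t powr (a - 1)) has_integral (r powr a)) {0..r}"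
      using assms by simp
    then have "(\<integral>\<^sup>+t. ennreal (a * t powr (a - 1)) * indicator {0..r} t \<partial>lborel) = ennreal (r powr a)"
      using assms by (intro nn_integral_has_integral_lebesgue') auto
    moreover have "AE t in lborel. t \<noteq> 0 \<and> t \<noteq> r"
      using AE_lborel_singleton[of "0::real"] AE_lborel_singleton[of r] by eventually_elim auto
    then have "(\<integral>\<^sup>+t. ennreal (a * t powr (a - 1)) * indicator {0..r} t \<partial>lborel)
      = (\<integral>\<^sup>+t. ennreal (a * t powr (a - 1)) * indicator {t. 0 < t \<and> ennreal t < ennreal r} t \<partial>lborel)"
      by (intro nn_integral_cong_AE) (elim eventually_mono, auto simp: indicator_def ennreal_less_iff)
    ultimately show ?thesis by simp
  qed
  show ?thesis
  proof (cases u)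
    case (real r)
    then show ?thesis using fin[of r] by simp
  next
    case top
    let ?I = "\<integral>\<^sup>+t. ennreal (a * t powr (a - 1)) * indicator {t. 0 < t \<and> ennreal t < u} t \<partial>lborel"
    have le: "of_nat N \<le> ?I" for N
    proof -
      define r where "r = real N powr (1 / a)"
      have "ennreal (r powr a) \<le> ?I"
        unfolding fin[of r, symmetric, unfolded r_def, OF powr_ge_zero] r_def
        by (intro nn_integral_mono mult_left_mono) (auto simp: indicator_def top)
      moreover have "r powr a = real N" using assms by (simp add: r_def powr_powr)
      ultimately show ?thesis by (simp add: ennreal_of_nat_eq_real_of_nat)
    qed
    have "?I = top"
    proof (rule ccontr)
      assume "?I \<noteq> top"
      then obtain n where "?I < of_nat n"
        using ennreal_Ex_less_of_nat by (auto simp: less_top)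
      with le[of n] show False by simp
    qed
    then show ?thesis using top by simp
  qed
qed

text \<open>The truncated weak type inequality is integrated against the layer cake formula; on the other
  side the layer cake formula for the exponent \<open>\<rho> - 1\<close> reappears, which needs \<open>\<rho> > 1\<close>.\<close>

lemma maximal_strong_type:
  fixes \<rho> :: real
  assumes "1 < \<rho>"
  obtains C :: real where "0 \<le> C"
    "\<And>k :: 'a::euclidean_space \<Rightarrow> ennreal. k \<in> borel_measurable lebesgue \<Longrightarrow>
      (\<integral>\<^sup>+x. epowr (maximal k x) \<rho> \<partial>lebesgue) \<le> ennreal C * (\<integral>\<^sup>+x. epowr (k x) \<rho> \<partial>lebesgue)"
proof
  define W where "W = 2 * weak_const TYPE('a)"
  define C where "C = W * \<rho> / (\<rho> - 1) * 2 powr (\<rho> - 1)"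
  have W: "0 \<le> W" using weak_const_pos[where 'a='a] by (simp add: W_def)
  show "0 \<le> C" using W assms by (simp add: C_def)
  fix k :: "'a \<Rightarrow> ennreal" assume [measurable]: "k \<in> borel_measurable lebesgue"
  interpret L: sigma_finite_measure "lebesgue :: 'a measure" by (rule sigma_finite_lebesgue)
  interpret P: pair_sigma_finite lborel "lebesgue :: 'a measure" ..
  let ?w = "\<lambda>t. ennreal (\<rho> * t powr (\<rho> - 1))"
  have [measurable]: "(\<lambda>(t, x). ?w t * indicator {t. 0 < t \<and> ennreal t < maximal k x} t)
      \<in> borel_measurable (lborel \<Otimes>\<^sub>M (lebesgue :: 'a measure))"
    unfolding indicator_def by measurable
  have [measurable]: "(\<lambda>(t, x). indicator {0<..} t * (?w t * ennreal (W / t)) * (k x * indicator {x. ennreal t < 2 * k x} x))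
      \<in> borel_measurable (lborel \<Otimes>\<^sub>M (lebesgue :: 'a measure))"
    unfolding indicator_def by measurable
  have "(\<integral>\<^sup>+x. epowr (maximal k x) \<rho> \<partial>lebesgue)
      = (\<integral>\<^sup>+x. \<integral>\<^sup>+t. ?w t * indicator {t. 0 < t \<and> ennreal t < maximal k x} t \<partial>lborel \<partial>lebesgue)"
    using assms by (subst epowr_layer_cake) auto
  also have "\<dots> = (\<integral>\<^sup>+t. \<integral>\<^sup>+x. ?w t * indicator {t. 0 < t \<and> ennreal t < maximal k x} t \<partial>lebesgue \<partial>lborel)"
    by (intro P.Fubini') simp
  also have "\<dots> \<le> (\<integral>\<^sup>+t. \<integral>\<^sup>+x. indicator {0<..} t * (?w t * ennreal (W / t))
      * (k x * indicator {x. ennreal t < 2 * k x} x) \<partial>lebesgue \<partial>lborel)"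
  proof (rule nn_integral_mono)
    fix t :: real
    show "(\<integral>\<^sup>+x. ?w t * indicator {t. 0 < t \<and> ennreal t < maximal k x} t \<partial>lebesgue)
      \<le> (\<integral>\<^sup>+x. indicator {0<..} t * (?w t * ennreal (W / t))
        * (k x * indicator {x. ennreal t < 2 * k x} x) \<partial>lebesgue)"
    proof (cases "0 < t")
      case True
      have "(\<integral>\<^sup>+x. ?w t * indicator {t. 0 < t \<and> ennreal t < maximal k x} t \<partial>lebesgue)
        = (\<integral>\<^sup>+x. ?w t * indicator {x. ennreal t < maximal k x} x \<partial>lebesgue)"
        using True by (intro nn_integral_cong) (auto simp: indicator_def)
      also have "\<dots> = ?w t * emeasure lebesgue {x. ennreal t < maximal k x}"
        by (intro nn_integral_cmult_indicator sets_less_maximal)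
      also have "\<dots> \<le> ?w t * (ennreal (W / t) * (\<integral>\<^sup>+x. k x * indicator {x. ennreal t < 2 * k x} x \<partial>lebesgue))"
        unfolding W_def by (intro mult_left_mono emeasure_less_maximal_le_truncated True) auto
      also have "\<dots> = (\<integral>\<^sup>+x. indicator {0<..} t * (?w t * ennreal (W / t))
        * (k x * indicator {x. ennreal t < 2 * k x} x) \<partial>lebesgue)"
        using True by (simp add: nn_integral_cmult mult.assoc)
      finally show ?thesis .
    qed simp
  qed
  also have "\<dots> = (\<integral>\<^sup>+x. \<integral>\<^sup>+t. indicator {0<..} t * (?w t * ennreal (W / t))
      * (k x * indicator {x. ennreal t < 2 * k x} x) \<partial>lborel \<partial>lebesgue)"
    by (intro P.Fubini'[symmetric]) simp
  also have "\<dots> = (\<integral>\<^sup>+x. ennreal C * epowr (k x) \<rho> \<partial>lebesgue)"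
  proof (intro nn_integral_cong)
    fix x :: 'a
    have "(\<integral>\<^sup>+t. indicator {0<..} t * (?w t * ennreal (W / t))
        * (k x * indicator {x. ennreal t < 2 * k x} x) \<partial>lborel)
      = (\<integral>\<^sup>+t. (ennreal (W * \<rho> / (\<rho> - 1)) * k x) *
          (ennreal ((\<rho> - 1) * t powr (\<rho> - 1 - 1)) * indicator {t. 0 < t \<and> ennreal t < 2 * k x} t) \<partial>lborel)"
    proof (intro nn_integral_cong)
      fix t :: real
      show "indicator {0<..} t * (?w t * ennreal (W / t))
        * (k x * indicator {x. ennreal t < 2 * k x} x)
        = (ennreal (W * \<rho> / (\<rho> - 1)) * k x) *
          (ennreal ((\<rho> - 1) * t powr (\<rho> - 1 - 1)) * indicator {t. 0 < t \<and> ennreal t < 2 * k x} t)"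
      proof (cases "0 < t \<and> ennreal t < 2 * k x")
        case True
        then have tpow: "t powr (\<rho> - 1) / t = t powr (\<rho> - 1 - 1)"
          by (simp add: powr_diff power2_eq_square)
        have "?w t * ennreal (W / t) = ennreal (W * \<rho> * (t powr (\<rho> - 1) / t))"
          using True W assms by (simp add: ennreal_mult'[symmetric] mult_ac)
        also have "\<dots> = ennreal (W * \<rho> / (\<rho> - 1)) * ennreal ((\<rho> - 1) * t powr (\<rho> - 1 - 1))"
          unfolding tpow using True W assms by (simp add: ennreal_mult'[symmetric])
        finally show ?thesis using True by (simp add: mult_ac)
      qed auto
    qed
    also have "\<dots> = (ennreal (W * \<rho> / (\<rho> - 1)) * k x) * epowr (2 * k x) (\<rho> - 1)"
      using epowr_layer_cake[of "\<rho> - 1" "2 * k x"] assms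
      by (subst nn_integral_cmult) auto
    also have "\<dots> = ennreal C * (epowr (k x) 1 * epowr (k x) (\<rho> - 1))"
    proof -
      have "ennreal C = ennreal (W * \<rho> / (\<rho> - 1)) * epowr 2 (\<rho> - 1)"
        using assms W epowr_ennreal[of 2 "\<rho> - 1"] by (simp add: C_def ennreal_mult''[symmetric])
      then show ?thesis using assms by (simp add: epowr_mult mult_ac)
    qed
    also have "\<dots> = ennreal C * epowr (k x) \<rho>"
      by (subst epowr_add) simp
    finally show "(\<integral>\<^sup>+t. indicator {0<..} t * (?w t * ennreal (W / t))
        * (k x * indicator {x. ennreal t < 2 * k x} x) \<partial>lborel) = ennreal C * epowr (k x) \<rho>" .
  qed
  also have "\<dots> = ennreal C * (\<integral>\<^sup>+x. epowr (k x) \<rho> \<partial>lebesgue)"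
    by (simp add: nn_integral_cmult)
  finally show "(\<integral>\<^sup>+x. epowr (maximal k x) \<rho> \<partial>lebesgue) \<le> ennreal C * (\<integral>\<^sup>+x. epowr (k x) \<rho> \<partial>lebesgue)" .
qed

section \<open>Log-Hoelder continuous exponents\<close>

lemma ln_exp_1_plus_norm_ge_1: "1 \<le> ln (exp 1 + norm x)"
  by (subst ln_ge_iff) (auto intro: add_pos_nonneg)

lemma tail_constant_nonneg:
  assumes "\<bar>u\<bar> \<le> c / ln (exp 1 + norm x)"
  shows "0 \<le> c"
  using assms ln_exp_1_plus_norm_ge_1[of x]
  by (metis abs_ge_zero dual_order.trans less_le_trans mult.commute pos_le_divide_eq zero_less_one mult_zero_right)

lemma limit_at_infinity_between:
  fixes p :: "'a::euclidean_space \<Rightarrow> real"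
  assumes lim: "\<And>x. \<bar>p x - pinf\<bar> \<le> c / ln (exp 1 + norm x)"
    and bounds: "\<And>x. a \<le> p x" "\<And>x. p x \<le> b"
  shows "a \<le> pinf" "pinf \<le> b"
proof -
  have c: "0 \<le> c" using tail_constant_nonneg[OF lim] .
  have near: "\<exists>x. \<bar>p x - pinf\<bar> \<le> e" if "0 < e" for e
  proof -
    obtain u :: 'a where u: "u \<in> Basis" using nonempty_Basis by blast
    define x where "x = exp (c / e) *\<^sub>R u"
    have "c / e = ln (norm x)" using u by (simp add: x_def)
    also have "\<dots> \<le> ln (exp 1 + norm x)"
      using u by (subst ln_le_cancel_iff) (auto simp: x_def intro: add_pos_pos)
    finally have "c / ln (exp 1 + norm x) \<le> e"
      using ln_exp_1_plus_norm_ge_1[of x] that by (simp add: field_simps)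
    then show ?thesis using lim[of x] by (intro exI[of _ x]) simp
  qed
  show "a \<le> pinf"
  proof (rule field_le_epsilon)
    fix e :: real assume "0 < e"
    then obtain x where "\<bar>p x - pinf\<bar> \<le> e" using near by blast
    then show "a \<le> pinf + e" using bounds(1)[of x] by linarith
  qed
  show "pinf \<le> b"
  proof (rule field_le_epsilon)
    fix e :: real assume "0 < e"
    then obtain x where "\<bar>p x - pinf\<bar> \<le> e" using near by blast
    then show "pinf \<le> b + e" using bounds(2)[of x] by linarith
  qed
qed

lemma LH_compose:
  fixes p :: "'a::euclidean_space \<Rightarrow> real"
  assumes "p \<in> LH" and bounds: "\<And>x. a \<le> p x" "\<And>x. p x \<le> b"
    and lip: "L-lipschitz_on {a..b} \<phi>"
  shows "(\<lambda>x. \<phi> (p x)) \<in> LH"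
proof -
  obtain C0 c pinf where
    loc: "\<And>x y. norm (x - y) < 1 / 2 \<Longrightarrow> \<bar>p x - p y\<bar> \<le> C0 / (- ln (norm (x - y)))"
    and lim: "\<And>x. \<bar>p x - pinf\<bar> \<le> c / ln (exp 1 + norm x)"
    using assms(1) unfolding LH_def by blast
  note pinf = limit_at_infinity_between[OF lim bounds]
  have L: "0 \<le> L" using lip by (rule lipschitz_on_nonneg)
  have le: "\<bar>\<phi> s - \<phi> t\<bar> \<le> L * \<bar>s - t\<bar>" if "s \<in> {a..b}" "t \<in> {a..b}" for s t
    using lipschitz_onD[OF lip that] by (simp add: dist_real_def)
  show ?thesis unfolding LH_def
  proof (intro CollectI exI conjI allI impI)
    fix x y :: 'a assume "norm (x - y) < 1 / 2"
    from mult_left_mono[OF loc[OF this] L]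
    have "L * \<bar>p x - p y\<bar> \<le> (L * C0) / (- ln (norm (x - y)))"
      unfolding times_divide_eq_right .
    then show "\<bar>\<phi> (p x) - \<phi> (p y)\<bar> \<le> (L * C0) / (- ln (norm (x - y)))"
      by (intro order.trans[OF le]) (simp_all add: bounds)
  next
    fix x :: 'a
    from mult_left_mono[OF lim L]
    have "L * \<bar>p x - pinf\<bar> \<le> (L * c) / ln (exp 1 + norm x)"
      unfolding times_divide_eq_right .
    then show "\<bar>\<phi> (p x) - \<phi> pinf\<bar> \<le> (L * c) / ln (exp 1 + norm x)"
      by (intro order.trans[OF le]) (simp_all add: bounds pinf)
  qed
qed

lemma LH_continuous:
  fixes p :: "'a::euclidean_space \<Rightarrow> real"
  assumes "p \<in> LH"
  shows "continuous_on UNIV p"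
proof -
  obtain C0 where
    loc: "\<And>x y. norm (x - y) < 1 / 2 \<Longrightarrow> \<bar>p x - p y\<bar> \<le> C0 / (- ln (norm (x - y)))"
    using assms unfolding LH_def by blast
  show ?thesis unfolding continuous_on_iff
  proof (intro ballI allI impI)
    fix x :: 'a and e :: real assume e: "0 < e"
    define d where "d = min (1 / 2) (exp (- (\<bar>C0\<bar> / e + 1)))"
    have "dist (p y) (p x) < e" if y: "dist y x < d" for y
    proof (cases "y = x")
      case False
      define t where "t = norm (y - x)"
      have t: "0 < t" "t < 1 / 2" "t < exp (- (\<bar>C0\<bar> / e + 1))"
        using False y by (auto simp: t_def d_def dist_norm)
      then have "ln t < - (\<bar>C0\<bar> / e + 1)"
        by (metis exp_gt_zero ln_exp ln_less_cancel_iff)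
      then have lt: "\<bar>C0\<bar> / e < - ln t" "0 < - ln t"
        using divide_nonneg_pos[OF abs_ge_zero e, of C0] by linarith+
      have "\<bar>p y - p x\<bar> \<le> C0 / (- ln t)" using loc[of y x] t by (simp add: t_def)
      also have "\<dots> \<le> \<bar>C0\<bar> / (- ln t)" by (intro divide_right_mono) (use lt in auto)
      also have "\<dots> < e" using lt e by (subst pos_divide_less_eq) (auto simp: field_simps)
      finally show ?thesis by (simp add: dist_real_def)
    qed (use e in simp)
    then show "\<exists>d>0. \<forall>x'\<in>UNIV. dist x' x < d \<longrightarrow> dist (p x') (p x) < e"
      by (intro exI[of _ d]) (auto simp: d_def)
  qed
qed

text \<open>The points at which a continuous function obeys a weak bound form a closed set, and a closed
  set of full measure is the whole space.\<close>

lemma continuous_bounds_everywhere: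
  fixes p :: "'a::euclidean_space \<Rightarrow> real"
  assumes "continuous_on UNIV p" "ereal a < exp_minus p" "exp_plus p < ereal b"
  obtains a' b' where "a < a'" "b' < b" "\<And>x. a' \<le> p x" "\<And>x. p x \<le> b'"
proof -
  have closed: "closed {x. a' \<le> p x}" "closed {x. p x \<le> b'}" for a' b'
    using assms(1) by (auto intro!: closed_Collect_le)
  obtain z where z: "ereal a < z" "AE x in lebesgue. z \<le> ereal (p x)"
    using assms(2) unfolding exp_minus_def less_Sup_iff by auto
  have "\<exists>x. z \<le> ereal (p x)"
  proof (rule ccontr)
    assume "\<nexists>x. z \<le> ereal (p x)"
    with z(2) have "AE x in lebesgue. x \<in> ({} :: 'a set)" by simp
    from mem_closed_if_AE_lebesgue[OF closed_empty this] show False by simp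
  qed
  with z(1) obtain a' where a': "z = ereal a'" by (cases z) auto
  have 1: "a' \<le> p x" for x
    using mem_closed_if_AE_lebesgue[OF closed(1)[of a'], of x] z(2) by (simp add: a')
  have AE: "AE x in lebesgue. ereal (p x) \<le> exp_plus p"
    unfolding exp_plus_def by (rule esssup_AE)
  have "exp_plus p \<noteq> -\<infinity>"
  proof
    assume "exp_plus p = -\<infinity>"
    with AE have "AE x in lebesgue. x \<in> ({} :: 'a set)" by simp
    from mem_closed_if_AE_lebesgue[OF closed_empty this] show False by simp
  qed
  with assms(3) obtain b' where b': "exp_plus p = ereal b'" by (cases "exp_plus p") auto
  have 2: "p x \<le> b'" for x
    using mem_closed_if_AE_lebesgue[OF closed(2)[of b'], of x] AE by (simp add: b')
  show ?thesis
    using 1 2 z(1) assms(3) by (intro that[of a' b']) (auto simp: a' b')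
qed

text \<open>Log-Hoelder continuity makes the difference of the exponents compensate the logarithm of the
  distance, which is at most a multiple of the side length; so a quantity bounded by a negative power of
  the side length may change its exponent inside the cube. Points at distance at least one half
  force the cube to be so large that the quantity is bounded.\<close>

lemma LH_oscillation:
  fixes r :: "'a::euclidean_space \<Rightarrow> real"
  assumes "r \<in> LH" "\<And>x. 0 \<le> r x" "\<And>x. r x \<le> R"
  obtains E :: real where "1 \<le> E" "\<And>x y a l B. 0 < l \<Longrightarrow> x \<in> cube_at a l \<Longrightarrow> y \<in> cube_at a l \<Longrightarrow>
    1 \<le> B \<Longrightarrow> B \<le> 2 * (1 + 1 / l ^ DIM('a)) \<Longrightarrow> B powr \<bar>r x - r y\<bar> \<le> E"
proof -
  obtain C0 where
    loc: "\<And>x y. norm (x - y) < 1 / 2 \<Longrightarrow> \<bar>r x - r y\<bar> \<le> C0 / (- ln (norm (x - y)))"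
    using assms(1) unfolding LH_def by blast
  define n where "n = DIM('a)"
  have n: "1 \<le> real n" by (simp add: n_def Suc_leI)
  define A where "A = (ln 4 + n * ln n) / ln 2 + n"
  define B1 where "B1 = 2 * (1 + (2 * real n) ^ n)"
  define E where "E = max (exp (\<bar>C0\<bar> * A)) (B1 powr R)"
  have A: "0 \<le> A" using n by (simp add: A_def)
  show ?thesis
  proof
    show "1 \<le> E" using A by (simp add: E_def le_max_iff_disj)
    fix x y a :: 'a and l B :: real
    assume l: "0 < l" and xy: "x \<in> cube_at a l" "y \<in> cube_at a l"
      and B: "1 \<le> B" "B \<le> 2 * (1 + 1 / l ^ DIM('a))"
    define d where "d = norm (x - y)"
    have R: "\<bar>r x - r y\<bar> \<le> R" using assms(2,3)[of x] assms(2,3)[of y] by linarith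
    show "B powr \<bar>r x - r y\<bar> \<le> E"
    proof (cases "d = 0")
      case True
      then show ?thesis using \<open>1 \<le> E\<close> B by (simp add: d_def)
    next
      case False
      then have d0: "0 < d" by (simp add: d_def)
      have "d \<le> (\<Sum>b\<in>Basis. \<bar>(x - y) \<bullet> b\<bar>)" unfolding d_def by (rule norm_le_l1)
      also have "\<dots> \<le> (\<Sum>b\<in>(Basis::'a set). l)"
      proof (rule sum_mono)
        fix b :: 'a assume "b \<in> Basis"
        then have "a \<bullet> b \<le> x \<bullet> b \<and> x \<bullet> b \<le> a \<bullet> b + l" "a \<bullet> b \<le> y \<bullet> b \<and> y \<bullet> b \<le> a \<bullet> b + l"
          using xy by (auto simp: mem_box inner_add_left)
        then show "\<bar>(x - y) \<bullet> b\<bar> \<le> l" by (simp add: inner_diff_left abs_le_iff)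
      qed
      finally have "d \<le> n * l" by (simp add: n_def)
      then have "1 / l \<le> n / d" using l d0 by (simp add: field_simps)
      then have "(1 / l) ^ n \<le> (n / d) ^ n" using l by (intro power_mono) auto
      then have B2: "B \<le> 2 * (1 + (n / d) ^ n)" using B by (simp add: n_def power_one_over)
      show ?thesis
      proof (cases "d < 1 / 2")
        case True
        have lnd: "ln 2 \<le> - ln d" using True d0
          by (simp add: ln_inverse[symmetric] field_simps)
        have pos: "0 < ln (2::real)" by simp
        have "1 \<le> (n / d) ^ n" using n True d0 by (intro one_le_power) (simp add: field_simps)
        moreover have "B \<le> 4 * v" if "B \<le> 2 * (1 + v)" "1 \<le> v" for v :: real
          using that(1) mult_left_mono[OF that(2), of 2] by (simp add: distrib_left)
        ultimately have "B \<le> 4 * (n / d) ^ n" using B2 by blast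
        then have "ln B \<le> ln (4 * (n / d) ^ n)" using B by (subst ln_le_cancel_iff) auto
        also have "\<dots> = ln 4 + n * ln n + n * (- ln d)"
          using n d0 by (simp add: ln_mult ln_realpow ln_div algebra_simps)
        also have "\<dots> \<le> (ln 4 + n * ln n) / ln 2 * (- ln d) + n * (- ln d)"
          using mult_left_mono[OF lnd, of "(ln 4 + n * ln n) / ln 2"] n pos by simp
        also have "\<dots> = A * (- ln d)" by (simp add: A_def algebra_simps)
        finally have lnB: "ln B \<le> A * (- ln d)" .
        have "\<bar>r x - r y\<bar> * ln B \<le> (\<bar>C0\<bar> / (- ln d)) * (A * (- ln d))"
        proof (rule mult_mono[OF _ lnB])
          have "\<bar>r x - r y\<bar> \<le> C0 / (- ln d)" using loc[of x y] True by (simp add: d_def)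
          also have "\<dots> \<le> \<bar>C0\<bar> / (- ln d)" using lnd pos by (intro divide_right_mono) linarith+
          finally show "\<bar>r x - r y\<bar> \<le> \<bar>C0\<bar> / (- ln d)" .
          show "0 \<le> \<bar>C0\<bar> / (- ln d)" using lnd pos by (intro divide_nonneg_nonneg) linarith+
        qed (use B in simp)
        also have "\<dots> = \<bar>C0\<bar> * A" using less_le_trans[OF pos lnd] by simp
        finally have "B powr \<bar>r x - r y\<bar> \<le> exp (\<bar>C0\<bar> * A)" using B by (simp add: powr_def)
        then show ?thesis by (simp add: E_def)
      next
        case False
        have "(n / d) ^ n \<le> (2 * real n) ^ n"
          using False d0 n by (intro power_mono) (auto simp: field_simps)
        with B2 have "B \<le> B1" by (simp add: B1_def)
        then have "B powr \<bar>r x - r y\<bar> \<le> B1 powr \<bar>r x - r y\<bar>" using B by (intro powr_mono2) auto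
        also have "\<dots> \<le> B1 powr R" using R B \<open>B \<le> B1\<close> by (intro powr_mono) auto
        finally show ?thesis by (simp add: E_def)
      qed
    qed
  qed
qed

text \<open>Far away, exponents may be changed for numbers \<open>t \<le> 1\<close>: either \<open>t\<close> is smaller than the
  tail, or it is so large that the decay of the exponent difference compensates.\<close>

lemma epowr_change_exponent:
  fixes t :: ennreal and x :: "'a::real_normed_vector"
  assumes "t \<le> 1" "\<bar>\<alpha> - \<beta>\<bar> \<le> c / ln (exp 1 + norm x)" "0 < \<alpha>" "0 \<le> m"
  shows "epowr t \<alpha> \<le> ennreal (exp (m * c)) * epowr t \<beta> + ennreal ((exp 1 + norm x) powr (- m * \<alpha>))"
proof -
  define X where "X = exp 1 + norm x"
  have X: "0 < X" "1 \<le> ln X"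
    using ln_exp_1_plus_norm_ge_1[of x] by (auto simp: X_def intro: add_pos_nonneg)
  obtain s where t: "t = ennreal s" "0 \<le> s" using assms(1) by (cases t) (auto simp: top_unique)
  have s: "s \<le> 1" using assms(1) t by (simp add: ennreal_1[symmetric] del: ennreal_1)
  have "s powr \<alpha> \<le> exp (m * c) * s powr \<beta> + X powr (- m * \<alpha>)"
  proof (cases "s < X powr (- m)")
    case True
    then have "s powr \<alpha> \<le> (X powr (- m)) powr \<alpha>" using t assms by (intro powr_mono2) auto
    then show ?thesis using X by (simp add: powr_powr add_increasing)
  next
    case False
    moreover have "0 < X powr (- m)" using X by simp
    ultimately have s0: "0 < s" by linarith
    have "s powr (\<alpha> - \<beta>) \<le> s powr (- \<bar>\<alpha> - \<beta>\<bar>)" using s0 s by (intro powr_mono') auto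
    also have "\<dots> \<le> (X powr (- m)) powr (- \<bar>\<alpha> - \<beta>\<bar>)"
      using False X by (intro powr_mono2') auto
    also have "\<dots> = exp (m * (\<bar>\<alpha> - \<beta>\<bar> * ln X))" using X by (simp add: powr_powr powr_def mult_ac)
    also have "\<dots> \<le> exp (m * c)"
    proof -
      have "\<bar>\<alpha> - \<beta>\<bar> * ln X \<le> c"
        using assms(2) X(2) unfolding X_def[symmetric] by (simp add: pos_le_divide_eq[OF less_le_trans[OF zero_less_one X(2)]])
      then show ?thesis using assms(4) by (simp add: mult_left_mono)
    qed
    finally have "s powr (\<alpha> - \<beta>) * s powr \<beta> \<le> exp (m * c) * s powr \<beta>"
      by (rule mult_right_mono) simp
    then have "s powr \<alpha> \<le> exp (m * c) * s powr \<beta>" by (simp add: powr_add[symmetric])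
    then show ?thesis by (rule order.trans) simp
  qed
  then show ?thesis using t
    by (simp add: X_def ennreal_mult'[symmetric] ennreal_plus[symmetric] ennreal_leI del: ennreal_plus)
qed

section \<open>The maximal operator with a variable exponent\<close>

definition tail :: "'a::euclidean_space \<Rightarrow> ennreal" where
  "tail x = ennreal ((exp 1 + norm x) powr - real DIM('a))"

lemma measurable_tail [measurable]: "tail \<in> borel_measurable lebesgue"
proof -
  have "(tail :: 'a \<Rightarrow> ennreal) \<in> borel_measurable borel" unfolding tail_def by measurable
  then show ?thesis by (simp add: measurable_completion)
qed

text \<open>Up to a factor, the tail is at most the maximal function of the indicator of a cube, to which
  the strong type inequality applies.\<close>

lemma tail_power_integrable:
  assumes "1 < \<rho>"
  shows "(\<integral>\<^sup>+x. epowr (tail (x::'a::euclidean_space)) \<rho> \<partial>lebesgue) < top"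
proof -
  let ?n = "DIM('a)" and ?u = "indicator (cube_at (0::'a) 1) :: 'a \<Rightarrow> ennreal"
  have le: "tail x \<le> ennreal (2 ^ ?n) * maximal ?u x" for x :: 'a
  proof -
    define X where "X = exp 1 + norm x"
    have X: "1 < X" "norm x < X"
      using add_strict_increasing2[of "norm x" 1 "exp 1"] by (auto simp: X_def)
    let ?a = "- X *\<^sub>R (One::'a)" and ?l = "2 * X"
    have "x \<in> open_cube_at ?a ?l"
      unfolding mem_box
    proof (intro ballI)
      fix b :: 'a assume b: "b \<in> Basis"
      have "\<bar>x \<bullet> b\<bar> < X" using Basis_le_norm[OF b, of x] X by linarith
      then show "?a \<bullet> b < x \<bullet> b \<and> x \<bullet> b < (?a + ?l *\<^sub>R One) \<bullet> b"
        using b by (auto simp: inner_add_left inner_diff_left)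
    qed
    then have "avg (cube_at ?a ?l) ?u \<le> maximal ?u x"
      using X by (intro avg_le_maximal) auto
    have "cube_at 0 1 \<subseteq> cube_at ?a ?l"
    proof
      fix y :: 'a assume y: "y \<in> cube_at 0 1"
      show "y \<in> cube_at ?a ?l"
        unfolding mem_box
      proof (intro ballI)
        fix b :: 'a assume b: "b \<in> Basis"
        then have "0 \<le> y \<bullet> b \<and> y \<bullet> b \<le> 1" using y by (simp add: mem_box)
        then show "?a \<bullet> b \<le> y \<bullet> b \<and> y \<bullet> b \<le> (?a + ?l *\<^sub>R One) \<bullet> b"
          using b X by (simp add: inner_add_left inner_diff_left)
      qed
    qed
    then have "(\<integral>\<^sup>+y\<in>cube_at ?a ?l. ?u y \<partial>lebesgue) = (\<integral>\<^sup>+y. ?u y \<partial>lebesgue)"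
      by (intro nn_integral_cong) (auto simp: indicator_def)
    also have "\<dots> = 1" by (simp add: emeasure_cube_at[of 1 0, simplified])
    finally have "1 = avg (cube_at ?a ?l) ?u * ennreal (?l ^ ?n)"
      using nn_integral_cube_at_eq_avg[of ?l ?u ?a] X by simp
    also have "\<dots> \<le> maximal ?u x * ennreal (?l ^ ?n)"
      by (intro mult_right_mono) (fact, simp)
    finally have 1: "1 \<le> maximal ?u x * ennreal (?l ^ ?n)" .
    have "tail x = tail x * 1" by simp
    also have "\<dots> \<le> tail x * (maximal ?u x * ennreal (?l ^ ?n))" by (intro mult_left_mono 1) simp
    also have "\<dots> = (tail x * ennreal (?l ^ ?n)) * maximal ?u x" by (simp add: mult_ac)
    also have "tail x * ennreal (?l ^ ?n) = ennreal (2 ^ ?n)"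
    proof -
      have "tail x * ennreal (?l ^ ?n) = ennreal (X powr - real ?n * ?l ^ ?n)"
        using X by (simp add: tail_def X_def[symmetric] ennreal_mult')
      also have "X powr - real ?n * ?l ^ ?n = 2 ^ ?n"
        using X by (simp add: powr_minus powr_realpow power_mult_distrib)
      finally show ?thesis .
    qed
    finally show ?thesis .
  qed
  obtain C where C: "0 \<le> C" "\<And>k :: 'a \<Rightarrow> ennreal. k \<in> borel_measurable lebesgue \<Longrightarrow>
      (\<integral>\<^sup>+x. epowr (maximal k x) \<rho> \<partial>lebesgue) \<le> ennreal C * (\<integral>\<^sup>+x. epowr (k x) \<rho> \<partial>lebesgue)"
    using maximal_strong_type[OF assms] by blast
  have "(\<integral>\<^sup>+x. epowr (tail (x::'a)) \<rho> \<partial>lebesgue)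
      \<le> (\<integral>\<^sup>+x. epowr (ennreal (2 ^ ?n)) \<rho> * epowr (maximal ?u x) \<rho> \<partial>lebesgue)"
  proof (rule nn_integral_mono)
    fix x :: 'a
    have "epowr (tail x) \<rho> \<le> epowr (ennreal (2 ^ ?n) * maximal ?u x) \<rho>"
      using assms le by (intro epowr_mono) auto
    then show "epowr (tail x) \<rho> \<le> epowr (ennreal (2 ^ ?n)) \<rho> * epowr (maximal ?u x) \<rho>"
      using assms by (simp only: epowr_mult)
  qed
  also have "\<dots> = epowr (ennreal (2 ^ ?n)) \<rho> * (\<integral>\<^sup>+x. epowr (maximal ?u x) \<rho> \<partial>lebesgue)"
    by (intro nn_integral_cmult) measurable
  also have "\<dots> \<le> epowr (ennreal (2 ^ ?n)) \<rho> * (ennreal C * (\<integral>\<^sup>+x. epowr (?u x) \<rho> \<partial>lebesgue))"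
    by (intro mult_left_mono C) (auto intro!: borel_measurable_indicator sets_completionI_sets)
  also have "(\<integral>\<^sup>+x. epowr (?u x) \<rho> \<partial>lebesgue) = (\<integral>\<^sup>+x. ?u x \<partial>lebesgue)"
    by (intro nn_integral_cong) (auto simp: indicator_def)
  also have "\<dots> = 1" by (simp add: emeasure_cube_at[of 1 0, simplified])
  finally show ?thesis
    by (rule order.strict_trans1) (simp add: ennreal_mult_less_top)
qed

text \<open>Let \<open>k = h^(r/\<rho>)\<close> and let \<open>B\<close> be its average over a cube. If \<open>B \<ge> 1\<close>, the threshold
  \<open>T = B^(\<rho>/r(x))\<close> bounds the average of \<open>h\<close> by a multiple of \<open>T\<close>: since \<open>B\<close> is at most a power of
  the side length, changing its exponent inside the cube costs only a factor.
  If \<open>B \<le> 1\<close>, the average of the part of \<open>h\<close> above one is at most \<open>B\<close>, and only the part below one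
  needs care; there the exponent is compared with its limit at infinity, at the price of the tail.\<close>

lemma maximal_pointwise:
  fixes r :: "'a::euclidean_space \<Rightarrow> real"
  assumes "r \<in> LH" and \<rho>: "1 < \<rho>" "\<And>x. \<rho> \<le> r x" and R: "\<And>x. r x \<le> R"
    and [measurable]: "r \<in> borel_measurable lebesgue"
  obtains C :: real where "0 \<le> C"
    "\<And>h x. h \<in> borel_measurable lebesgue \<Longrightarrow> (\<integral>\<^sup>+x. epowr (h x) (r x) \<partial>lebesgue) \<le> 1 \<Longrightarrow>
      epowr (maximal h x) (r x) \<le>
        ennreal C * (epowr (maximal (\<lambda>x. epowr (h x) (r x / \<rho>) + tail x) x) \<rho> + epowr (tail x) \<rho>)"
proof -
  have r0: "0 < r x" for x using \<rho>(2)[of x] \<rho>(1) by linarith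
  obtain E where E: "1 \<le> E" "\<And>x y a l B. 0 < l \<Longrightarrow> x \<in> cube_at a l \<Longrightarrow> y \<in> cube_at a l \<Longrightarrow>
    1 \<le> B \<Longrightarrow> B \<le> 2 * (1 + 1 / l ^ DIM('a)) \<Longrightarrow> B powr \<bar>r x - r y\<bar> \<le> E"
    using LH_oscillation[OF assms(1) less_imp_le[OF r0] R] by blast
  obtain c rinf where lim: "\<And>x. \<bar>r x - rinf\<bar> \<le> c / ln (exp 1 + norm x)"
    using assms(1) unfolding LH_def by blast
  note rinf = limit_at_infinity_between[OF lim \<rho>(2) R]
  have c: "0 \<le> c" using tail_constant_nonneg[OF lim] .
  define n where "n = real DIM('a)"
  define D where "D = exp (n * c)"
  have D: "1 \<le> D" using c by (simp add: D_def n_def)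
  define C1 where "C1 = (1 + E) powr R"
  define C2 where "C2 = 2 powr R * (1 + D * (2 powr R * D powr \<rho>))"
  have C12: "0 \<le> C1" "0 \<le> C2" using D by (auto simp: C1_def C2_def)
  show ?thesis
  proof
    show "0 \<le> C1 + C2" using C12 by simp
    fix h :: "'a \<Rightarrow> ennreal" and x :: 'a
    assume [measurable]: "h \<in> borel_measurable lebesgue"
      and h: "(\<integral>\<^sup>+x. epowr (h x) (r x) \<partial>lebesgue) \<le> 1"
    define k where "k = (\<lambda>x. epowr (h x) (r x / \<rho>))"
    have [measurable]: "k \<in> borel_measurable lebesgue" unfolding k_def by measurable
    define M where "M = maximal (\<lambda>x. k x + tail x) x"
    define Z where "Z = epowr M \<rho> + epowr (tail x) \<rho>"
    have main: "epowr (avg (cube_at a l) h) (r x) \<le> ennreal (C1 + C2) * Z"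
      if l: "0 < l" and x: "x \<in> open_cube_at a l" for a l
    proof -
      let ?Q = "cube_at a l"
      have xQ: "x \<in> ?Q" using x box_subset_cbox by blast
      have avgM: "avg ?Q (\<lambda>x. k x + tail x) \<le> M"
        unfolding M_def by (rule avg_le_maximal[OF l x])
      have kM: "avg ?Q k \<le> M"
        by (rule order.trans[OF avg_mono avgM]) simp
      have "avg ?Q (\<lambda>x. epowr (k x) \<rho>) * ennreal (l ^ DIM('a)) \<le> 1"
      proof -
        have "avg ?Q (\<lambda>x. epowr (k x) \<rho>) * ennreal (l ^ DIM('a)) = (\<integral>\<^sup>+x\<in>?Q. epowr (k x) \<rho> \<partial>lebesgue)"
          by (simp add: nn_integral_cube_at_eq_avg[OF l])
        also have "\<dots> \<le> (\<integral>\<^sup>+x. epowr (h x) (r x) \<partial>lebesgue)"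
          using \<rho> by (intro nn_integral_mono) (auto simp: k_def epowr_epowr indicator_def)
        finally show ?thesis using h by simp
      qed
      then have "avg ?Q (\<lambda>x. epowr (k x) \<rho>) \<le> ennreal (1 / l ^ DIM('a))"
      proof -
        assume "avg ?Q (\<lambda>x. epowr (k x) \<rho>) * ennreal (l ^ DIM('a)) \<le> 1"
        then have "avg ?Q (\<lambda>x. epowr (k x) \<rho>) * ennreal (l ^ DIM('a)) * ennreal (1 / l ^ DIM('a))
          \<le> 1 * ennreal (1 / l ^ DIM('a))"
          by (rule mult_right_mono) simp
        then show ?thesis using l by (simp add: mult.assoc ennreal_mult'[symmetric])
      qed
      then have "2 * epowr (avg ?Q (\<lambda>x. epowr (k x) \<rho>)) (1 / \<rho>)
          \<le> 2 * epowr (ennreal (1 / l ^ DIM('a))) (1 / \<rho>)"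
        using \<rho> by (intro mult_left_mono epowr_mono) auto
      also have "\<dots> = ennreal (2 * (1 / l ^ DIM('a)) powr (1 / \<rho>))"
        using l by (simp add: ennreal_mult)
      finally have "avg ?Q k \<le> ennreal (2 * (1 / l ^ DIM('a)) powr (1 / \<rho>))"
        using avg_le_epowr_avg[of k \<rho> l a] \<rho> l by simp
      moreover have "(1 / l ^ DIM('a)) powr (1 / \<rho>) \<le> 1 + 1 / l ^ DIM('a)"
      proof (cases "1 \<le> 1 / l ^ DIM('a)")
        case True
        then have "(1 / l ^ DIM('a)) powr (1 / \<rho>) \<le> (1 / l ^ DIM('a)) powr 1"
          using \<rho> by (intro powr_mono) auto
        then show ?thesis using l by simp
      next
        case False
        then have "(1 / l ^ DIM('a)) powr (1 / \<rho>) \<le> 1 powr (1 / \<rho>)"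
          using \<rho> l by (intro powr_mono2) auto
        then show ?thesis using l by (simp add: add_increasing2)
      qed
      ultimately obtain B where B: "avg ?Q k = ennreal B" "0 \<le> B" "B \<le> 2 * (1 + 1 / l ^ DIM('a))"
        by (cases "avg ?Q k") (auto simp: top_unique ennreal_le_iff2 intro: order.trans)
      show ?thesis
      proof (cases "1 \<le> B")
        case True
        \<comment> \<open>The power \<open>T^(r x)\<close> is \<open>B^\<rho>\<close>, the quantity that should appear on the right.\<close>
        define T where "T = B powr (\<rho> / r x)"
        have T: "0 < T" using True by (simp add: T_def)
        have "h y \<le> ennreal T + ennreal (T * E / B) * k y" if y: "y \<in> ?Q" for y
        proof -
          have "T powr (1 - r y / \<rho>) = T * (B powr ((r x - r y) / r x) / B)"
          proof -
            have e: "\<rho> / r x * (1 - r y / \<rho>) = \<rho> / r x + (r x - r y) / r x - 1"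
              using r0[of x] \<rho>(1) by (simp add: field_simps)
            have "T powr (1 - r y / \<rho>) = B powr (\<rho> / r x + (r x - r y) / r x - 1)"
              unfolding T_def powr_powr e ..
            also have "\<dots> = T * (B powr ((r x - r y) / r x) / B)"
              using True by (simp add: T_def powr_diff powr_add)
            finally show ?thesis .
          qed
          also have "\<dots> \<le> T * (B powr \<bar>r x - r y\<bar> / B)"
          proof -
            have "(r x - r y) / r x \<le> \<bar>r x - r y\<bar> / 1"
              using \<rho>(2)[of x] \<rho>(1) by (intro frac_le) auto
            then show ?thesis
              using True T by (intro mult_left_mono divide_right_mono powr_mono) auto
          qed
          also have "\<dots> \<le> T * (E / B)"
            using True T by (intro mult_left_mono divide_right_mono E(2)[OF l xQ y _ B(3)]) auto
          finally have "ennreal (T powr (1 - r y / \<rho>)) \<le> ennreal (T * E / B)"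
            by (intro ennreal_leI) simp
          moreover have "h y \<le> ennreal T + ennreal (T powr (1 - r y / \<rho>)) * k y"
            unfolding k_def using T \<rho>(1) \<rho>(2)[of y] by (intro le_threshold) auto
          ultimately show ?thesis
            by (elim order.trans) (intro add_left_mono mult_right_mono, auto)
        qed
        then have "avg ?Q h \<le> avg ?Q (\<lambda>y. ennreal T + ennreal (T * E / B) * k y)"
          by (rule avg_mono)
        also have "\<dots> = ennreal T + ennreal (T * E / B) * ennreal B"
          by (simp add: avg_add avg_cmult avg_const[OF l] B(1))
        also have "\<dots> = ennreal ((1 + E) * T)"
          using True T E(1) by (simp add: ennreal_mult'[symmetric] ennreal_plus[symmetric] algebra_simps del: ennreal_plus)
        finally have "epowr (avg ?Q h) (r x) \<le> epowr (ennreal ((1 + E) * T)) (r x)"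
          using r0 by (rule epowr_mono[rotated])
        also have "\<dots> = ennreal ((1 + E) powr r x * B powr \<rho>)"
          using T E(1) r0[of x] True by (simp add: powr_mult) (simp add: T_def powr_powr)
        also have "\<dots> \<le> ennreal (C1 * B powr \<rho>)"
          unfolding C1_def using E(1) R[of x] by (intro ennreal_leI mult_right_mono powr_mono) auto
        also have "\<dots> = ennreal C1 * epowr (avg ?Q k) \<rho>"
          using B C12 by (simp add: ennreal_mult)
        also have "\<dots> \<le> ennreal (C1 + C2) * Z"
          unfolding Z_def using C12 \<rho> kM
          by (intro mult_mono ennreal_leI add_increasing2 epowr_mono) auto
        finally show ?thesis .
      next
        case False
        define u where "u y = min (h y) 1" for y
        have [measurable]: "u \<in> borel_measurable lebesgue" unfolding u_def by measurable
        have u1: "u y \<le> 1" "u y \<le> h y" for y by (auto simp: u_def)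
        define A where "A = avg ?Q u"
        have A1: "A \<le> 1"
          unfolding A_def using avg_mono[of ?Q u "\<lambda>_. 1"] u1 by (simp add: avg_const[OF l])
        have split: "avg ?Q h \<le> avg ?Q k + A"
        proof -
          have "h y \<le> k y + u y" for y
          proof (cases "1 \<le> h y")
            case True
            then have "epowr (h y) 1 \<le> k y"
              unfolding k_def using \<rho>(1) \<rho>(2)[of y] by (intro epowr_exponent_mono) auto
            then show ?thesis by (simp add: add_increasing2)
          qed (auto simp: u_def min_def)
          then have "avg ?Q h \<le> avg ?Q (\<lambda>y. k y + u y)" by (intro avg_mono)
          then show ?thesis by (simp add: avg_add A_def)
        qed
        have near: "epowr (avg ?Q k) (r x) \<le> epowr M \<rho>"
        proof -
          have "epowr (avg ?Q k) (r x) \<le> epowr (avg ?Q k) \<rho>"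
            using \<rho>(1) \<rho>(2)[of x] False B by (intro epowr_exponent_antimono) auto
          also have "\<dots> \<le> epowr M \<rho>" using \<rho> kM by (intro epowr_mono) auto
          finally show ?thesis .
        qed
        have "epowr A rinf \<le> ennreal (2 powr R * D powr \<rho>) * epowr M \<rho>"
        proof -
          \<comment> \<open>Hoelder's inequality with the constant exponent \<open>rinf / \<rho>\<close>; the variable exponent
            is restored under the integral by a second comparison.\<close>
          let ?s = "rinf / \<rho>"
          have s: "1 \<le> ?s" using \<rho> rinf by simp
          have "epowr (u y) ?s \<le> ennreal D * (k y + tail y)" for y
          proof -
            have "\<bar>?s - r y / \<rho>\<bar> = \<bar>r y - rinf\<bar> / \<rho>"
              using \<rho> by (simp add: diff_divide_distrib[symmetric] abs_minus_commute)
            also have "\<dots> \<le> \<bar>r y - rinf\<bar> / 1" using \<rho> by (intro divide_left_mono) auto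
            finally have "\<bar>?s - r y / \<rho>\<bar> \<le> c / ln (exp 1 + norm y)" using lim[of y] by simp
            then have "epowr (u y) ?s \<le> ennreal D * epowr (u y) (r y / \<rho>) +
                ennreal ((exp 1 + norm y) powr (- n * ?s))"
              unfolding D_def using s u1 by (intro epowr_change_exponent) (auto simp: n_def)
            also have "\<dots> \<le> ennreal D * k y + ennreal D * tail y"
            proof (intro add_mono mult_left_mono)
              show "epowr (u y) (r y / \<rho>) \<le> k y"
                unfolding k_def using \<rho> r0 u1 by (intro epowr_mono) auto
              have "1 \<le> exp 1 + norm y" by (simp add: add_increasing2)
              then have "(exp 1 + norm y) powr (- n * ?s) \<le> (exp 1 + norm y) powr (- n)"
                using mult_left_mono[OF s, of n] by (intro powr_mono) (auto simp: n_def)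
              also have "\<dots> \<le> D * (exp 1 + norm y) powr (- n)"
                using D mult_right_mono[of 1 D "(exp 1 + norm y) powr (- n)"] by simp
              finally show "ennreal ((exp 1 + norm y) powr (- n * ?s)) \<le> ennreal D * tail y"
                using D by (simp add: tail_def n_def ennreal_mult'[symmetric] ennreal_leI)
            qed auto
            finally show ?thesis by (simp add: distrib_left)
          qed
          then have "avg ?Q (\<lambda>y. epowr (u y) ?s) \<le> avg ?Q (\<lambda>y. ennreal D * (k y + tail y))"
            by (rule avg_mono)
          also have "\<dots> \<le> ennreal D * M"
            by (subst avg_cmult) (auto intro: mult_left_mono avgM)
          finally have "2 * epowr (avg ?Q (\<lambda>y. epowr (u y) ?s)) (1 / ?s)
              \<le> 2 * epowr (ennreal D * M) (1 / ?s)"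
            using rinf(1) \<rho>(1) by (intro mult_left_mono epowr_mono) auto
          then have "A \<le> 2 * epowr (ennreal D * M) (1 / ?s)"
            unfolding A_def using avg_le_epowr_avg[of u ?s l a] s l by simp
          then have "epowr A rinf \<le> epowr (ennreal 2 * epowr (ennreal D * M) (1 / ?s)) rinf"
            using rinf \<rho> by (intro epowr_mono) auto
          also have "\<dots> = ennreal (2 powr rinf) * (ennreal (D powr \<rho>) * epowr M \<rho>)"
            using rinf \<rho> D by (simp add: epowr_mult epowr_epowr powr_powr del: ennreal_numeral)
          also have "\<dots> \<le> ennreal (2 powr R) * (ennreal (D powr \<rho>) * epowr M \<rho>)"
            using rinf by (intro mult_right_mono ennreal_leI) auto
          finally show ?thesis by (simp add: ennreal_mult mult.assoc)
        qed
        then have "ennreal D * epowr A rinf \<le> ennreal D * (ennreal (2 powr R * D powr \<rho>) * epowr M \<rho>)"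
          by (rule mult_left_mono) simp
        moreover have "epowr A (r x) \<le> ennreal D * epowr A rinf + epowr (tail x) \<rho>"
        proof -
          have "epowr A (r x) \<le> ennreal D * epowr A rinf +
              ennreal ((exp 1 + norm x) powr (- n * r x))"
            unfolding D_def using A1 r0 lim[of x] by (intro epowr_change_exponent) (auto simp: n_def)
          also have "(exp 1 + norm x) powr (- n * r x) \<le> (exp 1 + norm x) powr (- n * \<rho>)"
            using \<rho>(2)[of x] by (intro powr_mono) (auto simp: n_def add_increasing2)
          also have "ennreal \<dots> = epowr (tail x) \<rho>"
            by (simp add: tail_def n_def powr_powr)
          finally show ?thesis by (simp add: ennreal_leI add_left_mono)
        qed
        ultimately have far: "epowr A (r x) \<le> ennreal (D * (2 powr R * D powr \<rho>)) * epowr M \<rho> + epowr (tail x) \<rho>"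
          using D by (simp add: ennreal_mult mult.assoc) (meson add_right_mono order.trans)
        have "epowr (avg ?Q h) (r x) \<le> epowr (avg ?Q k + A) (r x)"
          using split r0 by (intro epowr_mono)
        also have "\<dots> \<le> ennreal (2 powr r x) * (epowr (avg ?Q k) (r x) + epowr A (r x))"
          by (rule epowr_add_le[OF r0])
        also have "\<dots> \<le> ennreal (2 powr R) *
            (epowr M \<rho> + (ennreal (D * (2 powr R * D powr \<rho>)) * epowr M \<rho> + epowr (tail x) \<rho>))"
          using R[of x] by (intro mult_mono add_mono near far ennreal_leI) auto
        also have "\<dots> \<le> ennreal (2 powr R) * (ennreal (1 + D * (2 powr R * D powr \<rho>)) * Z)"
        proof (rule mult_left_mono)
          have "epowr M \<rho> + (ennreal (D * (2 powr R * D powr \<rho>)) * epowr M \<rho> + epowr (tail x) \<rho>)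
              = Z + ennreal (D * (2 powr R * D powr \<rho>)) * epowr M \<rho>"
            by (simp add: Z_def ac_simps)
          also have "\<dots> \<le> Z + ennreal (D * (2 powr R * D powr \<rho>)) * Z"
            by (intro add_left_mono mult_left_mono) (auto simp: Z_def)
          also have "\<dots> = ennreal (1 + D * (2 powr R * D powr \<rho>)) * Z"
            using D by (simp add: ennreal_plus distrib_right)
          finally show "epowr M \<rho> + (ennreal (D * (2 powr R * D powr \<rho>)) * epowr M \<rho> + epowr (tail x) \<rho>)
            \<le> ennreal (1 + D * (2 powr R * D powr \<rho>)) * Z" .
        qed simp
        also have "\<dots> = ennreal C2 * Z"
          using D by (simp add: C2_def ennreal_mult mult.assoc)
        also have "\<dots> \<le> ennreal (C1 + C2) * Z"
          using C12 by (intro mult_right_mono ennreal_leI) auto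
        finally show ?thesis .
      qed
    qed
    have "maximal h x \<le> epowr (ennreal (C1 + C2) * Z) (1 / r x)"
      using main r0 by (intro maximal_le) (simp add: epowr_le_iff_le_epowr)
    then show "epowr (maximal h x) (r x) \<le> ennreal (C1 + C2) *
        (epowr (maximal (\<lambda>x. epowr (h x) (r x / \<rho>) + tail x) x) \<rho> + epowr (tail x) \<rho>)"
      using r0[of x] by (simp add: epowr_le_iff_le_epowr Z_def M_def k_def)
  qed
qed

lemma maximal_modular:
  fixes r :: "'a::euclidean_space \<Rightarrow> real"
  assumes "r \<in> LH" and \<rho>: "1 < \<rho>" "\<And>x. \<rho> \<le> r x" and R: "\<And>x. r x \<le> R"
    and [measurable]: "r \<in> borel_measurable lebesgue"
  obtains C :: real where "1 \<le> C"
    "\<And>h. h \<in> borel_measurable lebesgue \<Longrightarrow> (\<integral>\<^sup>+x. epowr (h x) (r x) \<partial>lebesgue) \<le> 1 \<Longrightarrow>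
      (\<integral>\<^sup>+x. epowr (maximal h x) (r x) \<partial>lebesgue) \<le> ennreal C"
proof -
  obtain C0 where C0: "0 \<le> C0" "\<And>h x. h \<in> borel_measurable lebesgue \<Longrightarrow>
      (\<integral>\<^sup>+x. epowr (h x) (r x) \<partial>lebesgue) \<le> 1 \<Longrightarrow> epowr (maximal h x) (r x) \<le>
        ennreal C0 * (epowr (maximal (\<lambda>x. epowr (h x) (r x / \<rho>) + tail x) x) \<rho> + epowr (tail x) \<rho>)"
    using maximal_pointwise[OF assms] by blast
  obtain C1 where C1: "0 \<le> C1" "\<And>k :: 'a \<Rightarrow> ennreal. k \<in> borel_measurable lebesgue \<Longrightarrow>
      (\<integral>\<^sup>+x. epowr (maximal k x) \<rho> \<partial>lebesgue) \<le> ennreal C1 * (\<integral>\<^sup>+x. epowr (k x) \<rho> \<partial>lebesgue)"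
    using maximal_strong_type[OF \<rho>(1)] by blast
  define \<sigma> where "\<sigma> = (\<integral>\<^sup>+x. epowr (tail (x::'a)) \<rho> \<partial>lebesgue)"
  have \<sigma>: "\<sigma> < top" unfolding \<sigma>_def by (rule tail_power_integrable[OF \<rho>(1)])
  define V where "V = ennreal C0 * (ennreal C1 * (ennreal (2 powr \<rho>) * (1 + \<sigma>)) + \<sigma>)"
  have "V < top" using \<sigma> by (simp add: V_def ennreal_mult_less_top)
  then obtain v where v: "V = ennreal v" by (cases V) auto
  show ?thesis
  proof
    show "1 \<le> max 1 v" by simp
    fix h :: "'a \<Rightarrow> ennreal"
    assume [measurable]: "h \<in> borel_measurable lebesgue"
      and h: "(\<integral>\<^sup>+x. epowr (h x) (r x) \<partial>lebesgue) \<le> 1"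
    define k where "k = (\<lambda>x. epowr (h x) (r x / \<rho>))"
    have [measurable]: "k \<in> borel_measurable lebesgue" unfolding k_def by measurable
    have kh: "epowr (k x) \<rho> = epowr (h x) (r x)" for x
      using \<rho> by (simp add: k_def epowr_epowr)
    have "(\<integral>\<^sup>+x. epowr (maximal h x) (r x) \<partial>lebesgue)
        \<le> (\<integral>\<^sup>+x. ennreal C0 * (epowr (maximal (\<lambda>x. k x + tail x) x) \<rho> + epowr (tail x) \<rho>) \<partial>lebesgue)"
      unfolding k_def by (intro nn_integral_mono C0 h) simp
    also have "\<dots> = ennreal C0 * ((\<integral>\<^sup>+x. epowr (maximal (\<lambda>x. k x + tail x) x) \<rho> \<partial>lebesgue) + \<sigma>)"
      by (simp add: nn_integral_cmult nn_integral_add \<sigma>_def)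
    also have "\<dots> \<le> ennreal C0 * (ennreal C1 * (\<integral>\<^sup>+x. epowr (k x + tail x) \<rho> \<partial>lebesgue) + \<sigma>)"
      by (intro mult_left_mono add_right_mono C1) auto
    also have "\<dots> \<le> ennreal C0 * (ennreal C1 *
        (\<integral>\<^sup>+x. ennreal (2 powr \<rho>) * (epowr (k x) \<rho> + epowr (tail x) \<rho>) \<partial>lebesgue) + \<sigma>)"
      using \<rho> by (intro mult_left_mono add_right_mono nn_integral_mono epowr_add_le) auto
    also have "\<dots> = ennreal C0 * (ennreal C1 *
        (ennreal (2 powr \<rho>) * ((\<integral>\<^sup>+x. epowr (h x) (r x) \<partial>lebesgue) + \<sigma>)) + \<sigma>)"
      by (simp add: nn_integral_cmult nn_integral_add \<sigma>_def kh)
    also have "\<dots> \<le> V"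
      unfolding V_def by (intro mult_left_mono add_right_mono h) auto
    also have "\<dots> \<le> ennreal (max 1 v)" unfolding v by (intro ennreal_leI) simp
    finally show "(\<integral>\<^sup>+x. epowr (maximal h x) (r x) \<partial>lebesgue) \<le> ennreal (max 1 v)" .
  qed
qed

section \<open>Majorants in the Muckenhoupt class $A_1$\<close>

text \<open>Boundedness guarantees that every positive power of \<open>H\<close> is locally integrable, also when the
  exponent is larger than those for which a modular of \<open>H\<close> is controlled.\<close>

definition bounded_A1 :: "real \<Rightarrow> ('a::euclidean_space \<Rightarrow> ennreal) \<Rightarrow> bool" where
  "bounded_A1 K H \<longleftrightarrow> H \<in> borel_measurable lebesgue \<and> (\<forall>x. 0 < H x) \<and>
     (\<exists>N. \<forall>x. H x \<le> ennreal N) \<and> (\<forall>x. maximal H x \<le> ennreal K * H x)"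

lemma suminf_const_geometric:
  "(\<Sum>k::nat. ennreal ((1 / 2) ^ Suc k) * c) = c"
proof -
  have "(\<Sum>k::nat. ennreal ((1 / 2) ^ Suc k)) = ennreal 1"
    by (rule suminf_ennreal_eq[OF _ power_half_series]) simp
  then show ?thesis by (simp only: ennreal_suminf_multc ennreal_1 mult_1_left)
qed

text \<open>The iteration algorithm of Rubio de Francia. After normalising, the maximal operator preserves
  the modular ball, so all its iterates stay there; a geometric series of the iterates is carried by
  the maximal operator into a multiple of itself. The modular of the series is controlled by those of
  its terms, because the series is at most the supremum of the terms with larger coefficients.\<close>

lemma A1_majorant:
  fixes r :: "'a::euclidean_space \<Rightarrow> real"
  assumes "r \<in> LH" and \<rho>: "1 < \<rho>" "\<And>x. \<rho> \<le> r x" and R: "\<And>x. r x \<le> R"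
    and [measurable]: "r \<in> borel_measurable lebesgue"
  obtains K D :: real where "1 \<le> K" "1 \<le> D"
    "\<And>h N. h \<in> borel_measurable lebesgue \<Longrightarrow> \<not> (AE x in lebesgue. h x = 0) \<Longrightarrow>
      (\<integral>\<^sup>+x. epowr (h x) (r x) \<partial>lebesgue) \<le> 1 \<Longrightarrow> (\<And>x. h x \<le> ennreal N) \<Longrightarrow> 0 \<le> N \<Longrightarrow>
      \<exists>H. bounded_A1 K H \<and> (\<forall>x. h x \<le> H x) \<and> (\<integral>\<^sup>+x. epowr (H x) (r x) \<partial>lebesgue) \<le> ennreal D"
proof -
  have r1: "1 \<le> r x" and r0: "0 < r x" for x using \<rho>(2)[of x] \<rho>(1) by linarith+
  have R0: "0 < R" using r0[of undefined] R[of undefined] by linarith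
  obtain C where C: "1 \<le> C" "\<And>h. h \<in> borel_measurable lebesgue \<Longrightarrow>
      (\<integral>\<^sup>+x. epowr (h x) (r x) \<partial>lebesgue) \<le> 1 \<Longrightarrow>
      (\<integral>\<^sup>+x. epowr (maximal h x) (r x) \<partial>lebesgue) \<le> ennreal C"
    using maximal_modular[OF assms] by blast
  show ?thesis
  proof
    show "1 \<le> 4 * C" using C by simp
    show "1 \<le> 2 powr R * 2" using ge_one_powr_ge_zero[of 2 R] R0 by simp
    fix h :: "'a \<Rightarrow> ennreal" and N :: real
    assume [measurable]: "h \<in> borel_measurable lebesgue" and nz: "\<not> (AE x in lebesgue. h x = 0)"
      and h: "(\<integral>\<^sup>+x. epowr (h x) (r x) \<partial>lebesgue) \<le> 1" and N: "\<And>x. h x \<le> ennreal N" "0 \<le> N"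
    \<comment> \<open>Dividing by \<open>C\<close> divides the modular by at least \<open>C\<close>, because \<open>r \<ge> 1\<close> and \<open>C \<ge> 1\<close>.\<close>
    define T where "T u x = ennreal (1 / C) * maximal u x" for u :: "'a \<Rightarrow> ennreal" and x
    define g where "g k = (T ^^ k) h" for k
    have g_0: "g 0 = h" and g_Suc: "g (Suc k) = T (g k)" for k by (simp_all add: g_def)
    have CT: "ennreal C * T u x = maximal u x" for u x
      using C by (simp add: T_def mult.assoc[symmetric] ennreal_mult'[symmetric])
    have [measurable]: "g k \<in> borel_measurable lebesgue" for k
    proof (cases k)
      case (Suc j)
      then show ?thesis unfolding Suc g_Suc T_def by measurable
    qed (simp add: g_0)
    have modular: "(\<integral>\<^sup>+x. epowr (g k x) (r x) \<partial>lebesgue) \<le> 1" for k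
    proof (induction k)
      case (Suc k)
      have "(\<integral>\<^sup>+x. epowr (g (Suc k) x) (r x) \<partial>lebesgue)
          \<le> (\<integral>\<^sup>+x. ennreal (1 / C) * epowr (maximal (g k) x) (r x) \<partial>lebesgue)"
      proof (rule nn_integral_mono)
        fix x :: 'a
        have "(1 / C) powr r x \<le> (1 / C) powr 1" using C r1 by (intro powr_mono') auto
        then have "epowr (ennreal (1 / C)) (r x) \<le> ennreal (1 / C)"
          using C by (simp add: ennreal_leI)
        then show "epowr (g (Suc k) x) (r x) \<le> ennreal (1 / C) * epowr (maximal (g k) x) (r x)"
          unfolding g_Suc T_def epowr_mult[OF r0] by (rule mult_right_mono) simp
      qed
      also have "\<dots> = ennreal (1 / C) * (\<integral>\<^sup>+x. epowr (maximal (g k) x) (r x) \<partial>lebesgue)"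
        by (intro nn_integral_cmult) measurable
      also have "\<dots> \<le> ennreal (1 / C) * ennreal C" by (intro mult_left_mono C Suc) simp_all
      also have "\<dots> = 1" using C by (simp add: ennreal_mult'[symmetric])
      finally show ?case .
    qed (simp add: g_0 h)
    have gN: "g k x \<le> ennreal N" for k x
    proof (induction k arbitrary: x)
      case (Suc k)
      have "T (g k) x \<le> 1 * ennreal N"
        unfolding T_def using C Suc
        by (intro mult_mono order.trans[OF maximal_mono maximal_const_le]) (auto simp: divide_le_eq_1)
      then show ?case by (simp add: g_Suc)
    qed (simp add: g_0 N)
    define H where "H x = (\<Sum>k. ennreal ((1 / 4) ^ k) * g k x)" for x
    have [measurable]: "H \<in> borel_measurable lebesgue" unfolding H_def by measurable
    have term_le: "ennreal ((1 / 4) ^ k) * g k x \<le> H x" for k x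
      unfolding H_def using sum_le_suminf[of "\<lambda>k. ennreal ((1 / 4) ^ k) * g k x" "{k}"] by simp
    have hH: "h x \<le> H x" for x using term_le[of 0 x] by (simp add: g_0)
    have pos: "0 < H x" for x
    proof -
      have "0 < ennreal ((1 / 4) ^ 1) * g 1 x"
        using maximal_pos[of h x] nz C by (simp add: g_0 g_Suc[of 0, simplified] T_def ennreal_zero_less_mult_iff)
      then show ?thesis using term_le[of 1 x] by (rule less_le_trans)
    qed
    have HN: "H x \<le> ennreal (2 * N)" for x
    proof -
      have "H x \<le> (\<Sum>k. ennreal ((1 / 2) ^ Suc k) * ennreal (2 * N))"
        unfolding H_def
      proof (intro suminf_le summableI)
        fix k
        have "(1 / 4) ^ k * N \<le> (1 / 2) ^ k * N" using N by (intro mult_right_mono power_mono) auto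
        then have "ennreal ((1 / 4) ^ k) * ennreal N \<le> ennreal ((1 / 2) ^ Suc k) * ennreal (2 * N)"
          using N by (simp add: ennreal_mult'[symmetric] ennreal_leI)
        then show "ennreal ((1 / 4) ^ k) * g k x \<le> ennreal ((1 / 2) ^ Suc k) * ennreal (2 * N)"
          by (rule order.trans[OF mult_left_mono[OF gN zero_le]])
      qed
      then show ?thesis by (simp only: suminf_const_geometric)
    qed
    have A1: "maximal H x \<le> ennreal (4 * C) * H x" for x
    proof -
      have "maximal H x \<le> (\<Sum>k. maximal (\<lambda>x. ennreal ((1 / 4) ^ k) * g k x) x)"
        unfolding H_def by (rule maximal_suminf_le) simp
      also have "\<dots> \<le> (\<Sum>k. ennreal (4 * C) * (ennreal ((1 / 4) ^ Suc k) * g (Suc k) x))"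
      proof (intro suminf_le summableI)
        fix k
        have "maximal (\<lambda>x. ennreal ((1 / 4) ^ k) * g k x) x \<le> ennreal ((1 / 4) ^ k) * maximal (g k) x"
          by (rule maximal_cmult_le) simp
        also have "\<dots> = ennreal (4 * C) * (ennreal ((1 / 4) ^ Suc k) * g (Suc k) x)"
        proof -
          have "(1 / 4) ^ k * C = 4 * C * (1 / 4) ^ Suc k" by simp
          then have "ennreal ((1 / 4) ^ k) * ennreal C = ennreal (4 * C) * ennreal ((1 / 4) ^ Suc k)"
            using C by (simp only: ennreal_mult'[symmetric] zero_le_power zero_le_divide_1_iff zero_le_numeral)
          then show ?thesis unfolding g_Suc CT[symmetric, of "g k"] by (simp only: mult.assoc[symmetric])
        qed
        finally show "maximal (\<lambda>x. ennreal ((1 / 4) ^ k) * g k x) x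
          \<le> ennreal (4 * C) * (ennreal ((1 / 4) ^ Suc k) * g (Suc k) x)" .
      qed
      also have "\<dots> = ennreal (4 * C) * (\<Sum>k. ennreal ((1 / 4) ^ Suc k) * g (Suc k) x)"
        by (rule ennreal_suminf_cmult)
      also have "(\<Sum>k. ennreal ((1 / 4) ^ Suc k) * g (Suc k) x) \<le> H x"
      proof (rule suminf_le_const)
        fix n
        have "(\<Sum>k<n. ennreal ((1 / 4) ^ Suc k) * g (Suc k) x)
          = (\<Sum>k\<in>Suc ` {..<n}. ennreal ((1 / 4) ^ k) * g k x)"
          by (subst sum.reindex) auto
        also have "\<dots> \<le> H x" unfolding H_def by (intro sum_le_suminf summableI) auto
        finally show "(\<Sum>k<n. ennreal ((1 / 4) ^ Suc k) * g (Suc k) x) \<le> H x" .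
      qed (rule summableI)
      finally show ?thesis by (simp add: mult_left_mono)
    qed
    have H_modular: "(\<integral>\<^sup>+x. epowr (H x) (r x) \<partial>lebesgue) \<le> ennreal (2 powr R * 2)"
    proof -
      have "epowr (H x) (r x) \<le> (\<Sum>k. ennreal (2 powr R * (1 / 2) ^ k) * epowr (g k x) (r x))" (is "_ \<le> ?z x") for x
      proof -
        have "ennreal ((1 / 4) ^ k) * g k x \<le> ennreal ((1 / 2) ^ Suc k) * epowr (?z x) (1 / r x)" for k
        proof -
          have "epowr (ennreal (2 * (1 / 2) ^ k) * g k x) (r x)
              = ennreal (2 powr r x * ((1 / 2) ^ k) powr r x) * epowr (g k x) (r x)"
            using r0[of x] by (simp add: epowr_mult powr_mult)
          also have "\<dots> \<le> ennreal (2 powr R * (1 / 2) ^ k) * epowr (g k x) (r x)"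
          proof (intro mult_right_mono ennreal_leI mult_mono)
            show "2 powr r x \<le> 2 powr R" using R[of x] by simp
            show "((1 / 2) ^ k) powr r x \<le> (1 / 2 :: real) ^ k"
              using powr_mono'[of 1 "r x" "(1 / 2) ^ k"] r1[of x] by (simp add: power_le_one)
          qed auto
          also have "\<dots> \<le> ?z x"
            using sum_le_suminf[of "\<lambda>k. ennreal (2 powr R * (1 / 2) ^ k) * epowr (g k x) (r x)" "{k}"] by simp
          finally have "ennreal (2 * (1 / 2) ^ k) * g k x \<le> epowr (?z x) (1 / r x)"
            using r0 by (simp add: epowr_le_iff_le_epowr)
          then have "ennreal ((1 / 2) ^ Suc k) * (ennreal (2 * (1 / 2) ^ k) * g k x)
              \<le> ennreal ((1 / 2) ^ Suc k) * epowr (?z x) (1 / r x)"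
            by (rule mult_left_mono) simp
          moreover have "(1 / 2) ^ Suc k * (2 * (1 / 2) ^ k) = (1 / 4 :: real) ^ k"
            by (simp add: power_mult_distrib[symmetric])
          then have "ennreal ((1 / 2) ^ Suc k) * (ennreal (2 * (1 / 2) ^ k) * g k x) = ennreal ((1 / 4) ^ k) * g k x"
            by (simp only: mult.assoc[symmetric] ennreal_mult'[symmetric] zero_le_power zero_le_divide_1_iff zero_le_numeral)
          ultimately show ?thesis by simp
        qed
        then have "H x \<le> (\<Sum>k. ennreal ((1 / 2) ^ Suc k) * epowr (?z x) (1 / r x))"
          unfolding H_def by (intro suminf_le summableI)
        then have "H x \<le> epowr (?z x) (1 / r x)" by (simp only: suminf_const_geometric)
        then show ?thesis using r0 by (simp add: epowr_le_iff_le_epowr)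
      qed
      then have "(\<integral>\<^sup>+x. epowr (H x) (r x) \<partial>lebesgue)
          \<le> (\<integral>\<^sup>+x. (\<Sum>k. ennreal (2 powr R * (1 / 2) ^ k) * epowr (g k x) (r x)) \<partial>lebesgue)"
        by (rule nn_integral_mono)
      also have "\<dots> = (\<Sum>k. ennreal (2 powr R * (1 / 2) ^ k) * (\<integral>\<^sup>+x. epowr (g k x) (r x) \<partial>lebesgue))"
        by (simp add: nn_integral_suminf nn_integral_cmult)
      also have "\<dots> \<le> (\<Sum>k. ennreal ((1 / 2) ^ Suc k) * ennreal (2 powr R * 2))"
      proof (intro suminf_le summableI)
        fix k
        have "ennreal (2 powr R * (1 / 2) ^ k) * (\<integral>\<^sup>+x. epowr (g k x) (r x) \<partial>lebesgue)
          \<le> ennreal (2 powr R * (1 / 2) ^ k) * 1"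
          by (intro mult_left_mono modular) simp
        also have "\<dots> = ennreal ((1 / 2) ^ Suc k) * ennreal (2 powr R * 2)"
          by (simp add: ennreal_mult'[symmetric] mult_ac)
        finally show "ennreal (2 powr R * (1 / 2) ^ k) * (\<integral>\<^sup>+x. epowr (g k x) (r x) \<partial>lebesgue)
          \<le> ennreal ((1 / 2) ^ Suc k) * ennreal (2 powr R * 2)" .
      qed
      finally show ?thesis by (simp only: suminf_const_geometric)
    qed
    have "bounded_A1 (4 * C) H" unfolding bounded_A1_def using pos HN A1 by auto
    then show "\<exists>H. bounded_A1 (4 * C) H \<and> (\<forall>x. h x \<le> H x) \<and>
        (\<integral>\<^sup>+x. epowr (H x) (r x) \<partial>lebesgue) \<le> ennreal (2 powr R * 2)"
      using hH H_modular by blast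
  qed
qed

section \<open>Reverse Hoelder constants\<close>

lemma RH_bound_comparable:
  assumes "0 < s" and [measurable]: "u \<in> borel_measurable lebesgue" "v \<in> borel_measurable lebesgue"
    and u: "\<And>x. u x \<le> ennreal a * v x" and v: "\<And>x. v x \<le> ennreal b * u x"
    and ab: "0 \<le> a" "0 \<le> b" and C: "RH_bound s v C"
  shows "RH_bound s u (a * b * C)"
  unfolding RH_bound_def
proof (intro conjI allI impI)
  show "0 \<le> a * b * C" using ab C by (simp add: RH_bound_def)
  fix Q :: "'a set" assume "cube Q"
  then have [measurable]: "Q \<in> sets lebesgue" by (auto simp: cube_def)
  have "avg Q (\<lambda>x. epowr (u x) s) \<le> avg Q (\<lambda>x. epowr (ennreal a) s * epowr (v x) s)"
    using assms(1) u by (intro avg_mono) (simp only: epowr_mult[symmetric] epowr_mono)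
  also have "\<dots> = epowr (ennreal a) s * avg Q (\<lambda>x. epowr (v x) s)" by (intro avg_cmult) auto
  finally have "epowr (avg Q (\<lambda>x. epowr (u x) s)) (1 / s)
      \<le> epowr (epowr (ennreal a) s * avg Q (\<lambda>x. epowr (v x) s)) (1 / s)"
    using assms(1) by (intro epowr_mono) auto
  also have "\<dots> = ennreal a * epowr (avg Q (\<lambda>x. epowr (v x) s)) (1 / s)"
    using assms(1) ab by (simp add: epowr_mult powr_powr)
  also have "\<dots> \<le> ennreal a * (ennreal C * avg Q v)"
    using C \<open>cube Q\<close> by (intro mult_left_mono) (auto simp: RH_bound_def)
  also have "\<dots> \<le> ennreal a * (ennreal C * (ennreal b * avg Q u))"
    by (intro mult_left_mono, subst avg_cmult[symmetric]) (auto intro: avg_mono v)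
  also have "\<dots> = ennreal (a * b * C) * avg Q u"
    using ab C by (simp add: RH_bound_def ennreal_mult mult_ac)
  finally show "epowr (avg Q (\<lambda>x. epowr (u x) s)) (1 / s) \<le> ennreal (a * b * C) * avg Q u" .
qed

lemma RH_const_le: "RH_bound s v C \<Longrightarrow> RH_const s v \<le> C"
  unfolding RH_const_def by (rule cInf_lower) (auto simp: RH_bound_def intro!: bdd_belowI[of _ 0])

lemma RH_const_greatest: "RH_bound s v C \<Longrightarrow> (\<And>C. RH_bound s v C \<Longrightarrow> c \<le> C) \<Longrightarrow> c \<le> RH_const s v"
  unfolding RH_const_def by (rule cInf_greatest) auto

lemma RH_const_nonneg: "RH_bound s v C \<Longrightarrow> 0 \<le> RH_const s v"
  by (rule RH_const_greatest) (auto simp: RH_bound_def)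

text \<open>Adding a function that the weight dominates changes the constant continuously, because nearby
  weights on the path are comparable with constants close to one. So every value between those at the
  two ends is the exact constant of some weight on the path.\<close>

lemma RH_const_intermediate_value:
  assumes s: "0 < s" and [measurable]: "v \<in> borel_measurable lebesgue" "\<phi> \<in> borel_measurable lebesgue"
    and L: "0 \<le> L" "\<And>x. \<phi> x \<le> ennreal L * v x" and T: "0 \<le> T"
    and C0: "RH_bound s v C0" "C0 \<le> y"
    and end_large: "\<And>C. RH_bound s (\<lambda>x. v x + ennreal T * \<phi> x) C \<Longrightarrow> y \<le> C"
  obtains t C where "0 \<le> t" "t \<le> T" "RH_const s (\<lambda>x. v x + ennreal t * \<phi> x) = y"
    "RH_bound s (\<lambda>x. v x + ennreal t * \<phi> x) C"
proof -
  define vt where "vt t x = v x + ennreal t * \<phi> x" for t x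
  have [measurable]: "vt t \<in> borel_measurable lebesgue" for t unfolding vt_def by measurable
  have up: "vt t x \<le> vt t' x" if "t \<le> t'" for t t' x
    unfolding vt_def using that by (intro add_left_mono mult_right_mono ennreal_leI) auto
  have down: "vt t' x \<le> ennreal (1 + (t' - t) * L) * vt t x" if "0 \<le> t" "t \<le> t'" for t t' x
  proof -
    have "ennreal t' = ennreal t + ennreal (t' - t)"
      using that by (simp add: ennreal_plus[symmetric] del: ennreal_plus)
    then have "vt t' x = vt t x + ennreal (t' - t) * \<phi> x"
      by (simp add: vt_def distrib_right add.assoc)
    also have "\<dots> \<le> vt t x + ennreal (t' - t) * (ennreal L * vt t x)"
      using L(2)[of x] by (intro add_left_mono mult_left_mono)
        (auto simp: vt_def distrib_left intro: add_increasing2)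
    also have "\<dots> = ennreal (1 + (t' - t) * L) * vt t x"
      using that L(1) by (simp add: ennreal_mult distrib_right mult.assoc)
    finally show ?thesis .
  qed
  have bound_up: "RH_bound s (vt t') ((1 + (t' - t) * L) * C)"
    if "0 \<le> t" "t \<le> t'" "RH_bound s (vt t) C" for t t' C
    using RH_bound_comparable[of s "vt t'" "vt t" "1 + (t' - t) * L" 1 C] s that L(1) down[of t t'] up[of t t']
    by simp
  have bound_down: "RH_bound s (vt t) ((1 + (t' - t) * L) * C)"
    if "0 \<le> t" "t \<le> t'" "RH_bound s (vt t') C" for t t' C
    using RH_bound_comparable[of s "vt t" "vt t'" 1 "1 + (t' - t) * L" C] s that L(1) down[of t t'] up[of t t']
    by simp
  have v0: "vt 0 = v" by (auto simp: vt_def)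
  have ex: "RH_bound s (vt t) ((1 + t * L) * C0)" if "0 \<le> t" for t
    using bound_up[of 0 t C0] that C0 v0 by simp
  define \<rho> where "\<rho> t = RH_const s (vt t)" for t
  have \<rho>0: "0 \<le> \<rho> t" if "0 \<le> t" for t
    unfolding \<rho>_def by (rule RH_const_nonneg[OF ex[OF that]])
  have scale: "b \<le> c * RH_const s u" if "RH_bound s u C" "0 < c" "\<And>C. RH_bound s u C \<Longrightarrow> b \<le> c * C" for b c u C
    using RH_const_greatest[of s u C "b / c"] that by (simp add: field_simps)
  have up\<rho>: "\<rho> t' \<le> (1 + (t' - t) * L) * \<rho> t" if "0 \<le> t" "t \<le> t'" for t t'
    unfolding \<rho>_def using that L(1)
    by (intro scale[OF ex]) (auto intro: RH_const_le bound_up add_pos_nonneg)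
  have down\<rho>: "\<rho> t \<le> (1 + (t' - t) * L) * \<rho> t'" if "0 \<le> t" "t \<le> t'" for t t'
    unfolding \<rho>_def using that L(1)
    by (intro scale[OF ex]) (auto intro: RH_const_le bound_down add_pos_nonneg)
  define M where "M = (1 + T * L) * C0"
  have \<rho>M: "\<rho> t \<le> M" if "0 \<le> t" "t \<le> T" for t
  proof -
    have "\<rho> t \<le> (1 + t * L) * C0" unfolding \<rho>_def by (rule RH_const_le[OF ex[OF that(1)]])
    also have "\<dots> \<le> M" unfolding M_def
      using that L(1) C0 by (intro mult_right_mono) (auto simp: RH_bound_def intro: mult_right_mono)
    finally show ?thesis .
  qed
  have lip: "\<bar>\<rho> t' - \<rho> t\<bar> \<le> (L * M) * \<bar>t' - t\<bar>" if "0 \<le> t" "t \<le> t'" "t' \<le> T" for t t'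
  proof -
    have "(t' - t) * L * \<rho> t \<le> (t' - t) * L * M" "(t' - t) * L * \<rho> t' \<le> (t' - t) * L * M"
      using that L(1) \<rho>M by (auto intro!: mult_left_mono)
    moreover have "\<rho> t' - \<rho> t \<le> (t' - t) * L * \<rho> t" "\<rho> t - \<rho> t' \<le> (t' - t) * L * \<rho> t'"
      using up\<rho>[OF that(1,2)] down\<rho>[OF that(1,2)] by (simp_all add: algebra_simps)
    ultimately have "\<bar>\<rho> t' - \<rho> t\<bar> \<le> (t' - t) * L * M" by linarith
    then show ?thesis using that by (simp add: mult_ac)
  qed
  have "(L * M)-lipschitz_on {0..T} \<rho>"
  proof (rule lipschitz_onI)
    show "0 \<le> L * M" using L(1) T C0 by (simp add: M_def RH_bound_def)
    fix t t' assume "t \<in> {0..T}" "t' \<in> {0..T}"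
    then show "dist (\<rho> t) (\<rho> t') \<le> L * M * dist t t'"
      using lip[of t t'] lip[of t' t] by (cases "t \<le> t'") (auto simp: dist_real_def abs_minus_commute)
  qed
  then have "continuous_on {0..T} \<rho>" by (rule lipschitz_on_continuous_on)
  moreover have "\<rho> 0 \<le> y"
    unfolding \<rho>_def v0 using RH_const_le[OF C0(1)] C0(2) by linarith
  moreover have "y \<le> \<rho> T"
    unfolding \<rho>_def using end_large by (intro RH_const_greatest[OF ex[OF T]]) (simp add: vt_def[abs_def])
  ultimately obtain t where "0 \<le> t" "t \<le> T" "\<rho> t = y"
    using IVT'[of \<rho> 0 y T] T by blast
  then show ?thesis
    using ex[of t] by (intro that) (auto simp: \<rho>_def vt_def[abs_def])
qed

text \<open>The spike adds at most \<open>2 * m\<close> to the average of the weight, however small its support is,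
  while its mean of order \<open>s\<close> grows without bound as the support shrinks.\<close>

lemma RH_bound_spike_ge:
  fixes v :: "'a::euclidean_space \<Rightarrow> ennreal"
  assumes s: "1 < s" and [measurable]: "v \<in> borel_measurable lebesgue"
    and m: "0 < m" "avg (cube_at 0 1) v \<le> ennreal (2 * m)"
    and \<epsilon>: "0 < \<epsilon>" "\<epsilon> \<le> 1" "(\<epsilon> ^ DIM('a)) powr (1 / s - 1) = 2 * y"
    and C: "RH_bound s (\<lambda>x. v x + ennreal (2 / \<epsilon> ^ DIM('a)) * (ennreal m * indicator (open_cube_at 0 \<epsilon>) x)) C"
  shows "y \<le> C"
proof -
  let ?Q = "cube_at (0::'a) 1" and ?E = "open_cube_at (0::'a) \<epsilon>"
  define \<delta> where "\<delta> = \<epsilon> ^ DIM('a)"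
  have \<delta>: "0 < \<delta>" using \<epsilon> by (simp add: \<delta>_def)
  define h where "h = 2 / \<delta> * m"
  have h: "0 < h" using \<delta> m by (simp add: h_def)
  have E: "?E \<subseteq> ?Q"
    using \<epsilon>(2) by (intro subset_box_imp(3)) (simp add: inner_add_left)
  have avg_ind: "avg ?Q (\<lambda>x. ennreal c * indicator ?E x) = ennreal (c * \<delta>)" if "0 \<le> c" for c
  proof -
    have "(\<integral>\<^sup>+x\<in>?Q. (ennreal c * indicator ?E x) \<partial>lebesgue) = (\<integral>\<^sup>+x. ennreal c * indicator ?E x \<partial>lebesgue)"
      using E by (intro nn_integral_cong) (auto simp: indicator_def)
    also have "\<dots> = ennreal c * emeasure lebesgue ?E"
      by (intro nn_integral_cmult_indicator sets_completionI_sets) auto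
    also have "emeasure lebesgue ?E = ennreal \<delta>"
      using \<epsilon> by (simp add: emeasure_lborel_box_eq inner_add_left \<delta>_def less_imp_le)
    finally show ?thesis
      using that \<delta> nn_integral_cube_at_eq_avg[of 1 "\<lambda>x. ennreal c * indicator ?E x" 0]
      by (simp add: ennreal_mult)
  qed
  define u where "u x = v x + ennreal h * indicator ?E x" for x
  have spike [measurable]: "(\<lambda>x. ennreal h * indicator ?E x) \<in> borel_measurable lebesgue"
    by (intro borel_measurable_times_ennreal borel_measurable_indicator sets_completionI_sets) auto
  have [measurable]: "u \<in> borel_measurable lebesgue"
    unfolding u_def by (intro borel_measurable_add) measurable
  have C': "RH_bound s u C"
  proof -
    have "u = (\<lambda>x. v x + ennreal (2 / \<epsilon> ^ DIM('a)) * (ennreal m * indicator ?E x))"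
    proof
      fix x
      have "ennreal h = ennreal (2 / \<epsilon> ^ DIM('a)) * ennreal m"
        using m \<epsilon>(1) by (simp add: h_def \<delta>_def ennreal_mult'[symmetric])
      then show "u x = v x + ennreal (2 / \<epsilon> ^ DIM('a)) * (ennreal m * indicator ?E x)"
        by (simp add: u_def mult.assoc)
    qed
    then show ?thesis using C by simp
  qed
  then have C0: "0 \<le> C" by (simp add: RH_bound_def)
  have "cube ?Q" unfolding cube_def by (intro exI[of _ 0] exI[of _ 1]) auto
  then have "epowr (avg ?Q (\<lambda>x. epowr (u x) s)) (1 / s) \<le> ennreal C * avg ?Q u"
    using C' by (simp add: RH_bound_def)
  moreover have "ennreal (h * \<delta> powr (1 / s)) \<le> epowr (avg ?Q (\<lambda>x. epowr (u x) s)) (1 / s)"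
  proof -
    have "ennreal (h powr s * \<delta>) = avg ?Q (\<lambda>x. ennreal (h powr s) * indicator ?E x)"
      by (subst avg_ind) auto
    also have "\<dots> \<le> avg ?Q (\<lambda>x. epowr (u x) s)"
    proof (rule avg_mono)
      fix x
      have "epowr (ennreal h * indicator ?E x) s \<le> epowr (u x) s"
        using s by (intro epowr_mono) (auto simp: u_def)
      then show "ennreal (h powr s) * indicator ?E x \<le> epowr (u x) s"
        using h by (cases "x \<in> ?E") auto
    qed
    finally have "epowr (ennreal (h powr s * \<delta>)) (1 / s) \<le> epowr (avg ?Q (\<lambda>x. epowr (u x) s)) (1 / s)"
      using s by (intro epowr_mono) auto
    then show ?thesis using s h \<delta> by (simp add: powr_mult powr_powr)
  qed
  moreover have "avg ?Q u \<le> ennreal (4 * m)"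
  proof -
    have "avg ?Q u = avg ?Q v + ennreal (h * \<delta>)"
      unfolding u_def using h by (subst avg_add[OF assms(2) spike]) (simp_all only: avg_ind less_imp_le, simp)
    also have "\<dots> \<le> ennreal (2 * m) + ennreal (2 * m)"
      using m \<delta> by (intro add_mono) (auto simp: h_def)
    also have "\<dots> = ennreal (4 * m)"
      using m by (subst ennreal_plus[symmetric]) auto
    finally show ?thesis .
  qed
  then have "ennreal C * avg ?Q u \<le> ennreal C * ennreal (4 * m)" by (rule mult_left_mono) simp
  ultimately have "ennreal (h * \<delta> powr (1 / s)) \<le> ennreal C * ennreal (4 * m)"
    by (meson order.trans)
  then have "h * \<delta> powr (1 / s) \<le> C * (4 * m)"
    using C0 m by (simp add: ennreal_mult'[symmetric] ennreal_le_iff)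
  moreover have "h * \<delta> powr (1 / s) = 2 * m * \<delta> powr (1 / s - 1)"
    using \<delta> by (simp add: h_def powr_diff)
  ultimately show ?thesis using \<epsilon>(3) m by (simp add: \<delta>_def)
qed

text \<open>The height of the spike is increased until the constant takes a value fixed in advance. The
  $A_1$ condition bounds the weight on the unit cube from below by its mean there, so the spike stays
  below a fixed multiple of the weight. As the constant of a weighted inequality may depend on
  the reverse Hoelder constant in an arbitrary way, only the exact value makes the inequality
  uniform over the weights obtained.\<close>

lemma A1_comparable_RH_const_eq:
  fixes s K :: real
  assumes s: "1 < s" and K: "1 \<le> K"
  obtains y \<Lambda> :: real where "1 \<le> \<Lambda>"
    "\<forall>H :: 'a::euclidean_space \<Rightarrow> ennreal. bounded_A1 K H \<longrightarrow>
      (\<exists>v C. v \<in> borel_measurable lebesgue \<and> (\<forall>x. epowr (H x) (1 / s) \<le> v x) \<and>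
        (\<forall>x. v x \<le> ennreal \<Lambda> * epowr (H x) (1 / s)) \<and> RH_bound s v C \<and> RH_const s v = y)"
proof -
  \<comment> \<open>A bound for the constant at the start of the path; any larger number can serve as \<open>y\<close>.\<close>
  define L where "L = K powr (1 / s)"
  define y where "y = L + 1"
  define n where "n = DIM('a)"
  have L: "1 \<le> L" using K s by (simp add: L_def ge_one_powr_ge_zero)
  \<comment> \<open>Solves \<open>(\<epsilon> ^ n) powr (1 / s - 1) = 2 * y\<close>, the size of spike that forces the constant up to \<open>y\<close>.\<close>
  define \<epsilon> where "\<epsilon> = (2 * y) powr (- (s / (s - 1)) / real n)"
  have n: "0 < n" by (simp add: n_def)
  have y: "1 < y" using L by (simp add: y_def)
  have \<epsilon>: "0 < \<epsilon>" "\<epsilon> \<le> 1" "(\<epsilon> ^ n) powr (1 / s - 1) = 2 * y"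
  proof -
    show "0 < \<epsilon>" using y by (simp add: \<epsilon>_def)
    have "(2 * y) powr (- (s / (s - 1)) / real n) \<le> (2 * y) powr 0"
      using y s n by (intro powr_mono) (auto simp: field_simps)
    then show "\<epsilon> \<le> 1" using y by (simp add: \<epsilon>_def)
    have "(\<epsilon> ^ n) powr (1 / s - 1) = (2 * y) powr (- (s / (s - 1)) * (1 / s - 1))"
      using n y by (simp add: \<epsilon>_def powr_realpow[symmetric] powr_powr)
    also have "- (s / (s - 1)) * (1 / s - 1) = 1" using s by (simp add: field_simps)
    finally show "(\<epsilon> ^ n) powr (1 / s - 1) = 2 * y" using y by simp
  qed
  define T where "T = 2 / \<epsilon> ^ n"
  have T: "0 \<le> T" using \<epsilon> by (simp add: T_def)
  show ?thesis
  proof (rule that, safe)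
    show "1 \<le> 1 + T * L" using T L by simp
    fix H :: "'a \<Rightarrow> ennreal" assume "bounded_A1 K H"
    then obtain N where [measurable]: "H \<in> borel_measurable lebesgue" and H0: "\<And>x. 0 < H x"
      and HN: "\<And>x. H x \<le> ennreal N" and A1: "\<And>x. maximal H x \<le> ennreal K * H x"
      unfolding bounded_A1_def by blast
    define v where "v x = epowr (H x) (1 / s)" for x
    have [measurable]: "v \<in> borel_measurable lebesgue" unfolding v_def by measurable
    have vH: "(\<lambda>x. epowr (v x) s) = H" using s by (simp add: v_def)
    have avg_le: "epowr (avg (cube_at a l) H) (1 / s) \<le> ennreal L * v x"
      if "0 < l" "x \<in> open_cube_at a l" for a l x
    proof -
      have "avg (cube_at a l) H \<le> ennreal K * H x"
        using avg_le_maximal[OF that] A1 order.trans by blast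
      then have "epowr (avg (cube_at a l) H) (1 / s) \<le> epowr (ennreal K * H x) (1 / s)"
        using s by (intro epowr_mono) auto
      then show ?thesis using s K by (simp add: epowr_mult L_def v_def)
    qed
    have "RH_bound s v L"
      unfolding RH_bound_def vH
    proof (intro conjI allI impI)
      show "0 \<le> L" using L by simp
      fix Q :: "'a set" assume "cube Q"
      then obtain a l where l: "0 < l" and Q: "Q = cube_at a l" by (auto simp: cube_def)
      have "epowr (avg Q H) (1 / s) = avg Q (\<lambda>_. epowr (avg Q H) (1 / s))"
        unfolding Q by (simp add: avg_const[OF l])
      also have "\<dots> \<le> avg Q (\<lambda>x. ennreal L * v x)"
        unfolding Q by (rule avg_mono_open_cube[OF avg_le[OF l]])
      also have "\<dots> = ennreal L * avg Q v" unfolding Q by (intro avg_cmult) auto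
      finally show "epowr (avg Q H) (1 / s) \<le> ennreal L * avg Q v" .
    qed
    let ?Q = "cube_at (0::'a) 1"
    have "avg ?Q H \<le> avg ?Q (\<lambda>_. ennreal N)" by (intro avg_mono HN)
    also have "\<dots> = ennreal N" by (rule avg_const) simp
    finally have fin: "avg ?Q H < top" by (rule le_less_trans) simp
    have "0 < avg ?Q H"
    proof (rule ccontr)
      assume "\<not> 0 < avg ?Q H"
      then have "(\<integral>\<^sup>+x\<in>?Q. H x \<partial>lebesgue) = 0" by (subst nn_integral_cube_at_eq_avg) auto
      then have "AE x in lebesgue. H x * indicator ?Q x = 0"
        by (subst (asm) nn_integral_0_iff_AE) (auto intro!: borel_measurable_times_ennreal
          borel_measurable_indicator sets_completionI_sets)
      then have "AE x in lebesgue. x \<notin> ?Q"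
        using H0 by (elim eventually_mono) (auto simp: indicator_def H0[THEN less_imp_neq, symmetric])
      then have "emeasure lebesgue ?Q = 0"
        by (subst (asm) AE_iff_measurable[of ?Q]) auto
      then show False using emeasure_cube_at_pos_finite[of 1 "0::'a"] by simp
    qed
    with fin s have "0 < epowr (avg ?Q H) (1 / s)" "epowr (avg ?Q H) (1 / s) < top"
      by (simp_all add: zero_less_iff_neq_zero)
    then obtain m where m: "epowr (avg ?Q H) (1 / s) = ennreal m" "0 < m"
      by (cases "epowr (avg ?Q H) (1 / s)") auto
    define \<phi> where "\<phi> x = ennreal m * indicator (open_cube_at (0::'a) \<epsilon>) x" for x
    have [measurable]: "\<phi> \<in> borel_measurable lebesgue"
      unfolding \<phi>_def
      by (intro borel_measurable_times_ennreal borel_measurable_indicator sets_completionI_sets) auto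
    have \<phi>: "\<phi> x \<le> ennreal L * v x" for x
    proof (cases "x \<in> open_cube_at (0::'a) \<epsilon>")
      case True
      then have "x \<in> open_cube_at (0::'a) 1"
        using \<epsilon>(2) by (rule_tac subsetD[OF subset_box_imp(4)]) (simp_all add: inner_add_left)
      then show ?thesis using avg_le[of 1 x 0] m True by (simp add: \<phi>_def)
    qed (simp add: \<phi>_def)
    have "avg ?Q v \<le> ennreal (2 * m)"
      using avg_le_epowr_avg[of v s 1 0] s m unfolding vH by (simp add: ennreal_mult)
    then have large: "y \<le> C" if "RH_bound s (\<lambda>x. v x + ennreal T * \<phi> x) C" for C
      using RH_bound_spike_ge[OF s _ m(2) _ \<epsilon>[unfolded n_def], of v C] that
      by (simp add: T_def \<phi>_def n_def)
    obtain t C where t: "0 \<le> t" "t \<le> T" "RH_const s (\<lambda>x. v x + ennreal t * \<phi> x) = y"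
      "RH_bound s (\<lambda>x. v x + ennreal t * \<phi> x) C"
      using RH_const_intermediate_value[of s v \<phi> L T L y] s L T \<phi> \<open>RH_bound s v L\<close> large
      by (auto simp: y_def)
    have "v x + ennreal t * \<phi> x \<le> ennreal (1 + T * L) * v x" for x
    proof -
      have "v x + ennreal t * \<phi> x \<le> v x + ennreal T * (ennreal L * v x)"
        using t by (intro add_left_mono mult_mono \<phi> ennreal_leI) auto
      also have "\<dots> = ennreal (1 + T * L) * v x"
        using T L by (simp add: distrib_right ennreal_mult mult.assoc)
      finally show ?thesis .
    qed
    then show "\<exists>v C. v \<in> borel_measurable lebesgue \<and> (\<forall>x. epowr (H x) (1 / s) \<le> v x) \<and>
        (\<forall>x. v x \<le> ennreal (1 + T * L) * epowr (H x) (1 / s)) \<and> RH_bound s v C \<and> RH_const s v = y"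
      using t by (intro exI[of _ "\<lambda>x. v x + ennreal t * \<phi> x"] exI[of _ C]) (auto simp: v_def)
  qed
qed

section \<open>Variable Lebesgue norms\<close>

lemma divide_ennreal_eq_mult: "0 < l \<Longrightarrow> x / ennreal l = ennreal (1 / l) * x"
  by (simp add: divide_ennreal_def inverse_ennreal inverse_eq_divide mult.commute)

lemma var_norm_le:
  "0 < l \<Longrightarrow> (\<integral>\<^sup>+x. epowr (f x / ennreal l) (p x) \<partial>lebesgue) \<le> 1 \<Longrightarrow> var_norm p f \<le> ennreal l"
  unfolding var_norm_def by (rule Inf_lower) auto

lemma var_norm_lessE:
  assumes "var_norm p f < c"
  obtains l where "0 < l" "ennreal l < c" "(\<integral>\<^sup>+x. epowr (f x / ennreal l) (p x) \<partial>lebesgue) \<le> 1"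
  using assms unfolding var_norm_def Inf_less_iff by auto

lemma le_mult_var_normI:
  assumes "0 < c"
    and le: "\<And>l. 0 < l \<Longrightarrow> (\<integral>\<^sup>+x. epowr (f x / ennreal l) (p x) \<partial>lebesgue) \<le> 1 \<Longrightarrow> u \<le> ennreal c * ennreal l"
  shows "u \<le> ennreal c * var_norm p f"
proof -
  have inv: "ennreal (1 / c) * (ennreal c * z) = z" "ennreal c * (ennreal (1 / c) * z) = z" for z
    using assms(1) by (simp_all add: mult.assoc[symmetric] ennreal_mult'[symmetric])
  have "ennreal (1 / c) * u \<le> var_norm p f"
    unfolding var_norm_def
  proof (rule Inf_greatest)
    fix z assume "z \<in> ennreal ` {l. 0 < l \<and> (\<integral>\<^sup>+x. epowr (f x / ennreal l) (p x) \<partial>lebesgue) \<le> 1}"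
    then obtain l where "z = ennreal l" "0 < l" "(\<integral>\<^sup>+x. epowr (f x / ennreal l) (p x) \<partial>lebesgue) \<le> 1"
      by auto
    then have "ennreal (1 / c) * u \<le> ennreal (1 / c) * (ennreal c * z)"
      by (auto intro!: mult_left_mono le)
    then show "ennreal (1 / c) * u \<le> z" by (simp only: inv)
  qed
  then have "ennreal c * (ennreal (1 / c) * u) \<le> ennreal c * var_norm p f"
    by (rule mult_left_mono) simp
  then show ?thesis by (simp only: inv)
qed

text \<open>Half the norm lies strictly below the infimum that defines the norm, and some admissible
  number lies below twice the norm, so less than four times half the norm.\<close>

lemma modular_half_norm:
  assumes \<kappa>: "0 < \<kappa>" "var_norm p f = ennreal (2 * \<kappa>)" and p: "\<And>x. 0 < p x" "\<And>x. p x \<le> P"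
    and [measurable]: "f \<in> borel_measurable lebesgue" "p \<in> borel_measurable lebesgue"
  shows "1 < (\<integral>\<^sup>+x. epowr (f x / ennreal \<kappa>) (p x) \<partial>lebesgue)"
    "(\<integral>\<^sup>+x. epowr (f x / ennreal \<kappa>) (p x) \<partial>lebesgue) \<le> ennreal (4 powr P)"
proof -
  show "1 < (\<integral>\<^sup>+x. epowr (f x / ennreal \<kappa>) (p x) \<partial>lebesgue)"
  proof (rule ccontr)
    assume "\<not> 1 < (\<integral>\<^sup>+x. epowr (f x / ennreal \<kappa>) (p x) \<partial>lebesgue)"
    then have "ennreal (2 * \<kappa>) \<le> ennreal \<kappa>"
      unfolding \<kappa>(2)[symmetric] using \<kappa>(1) by (intro var_norm_le) auto
    with \<kappa>(1) show False by (simp add: ennreal_le_iff)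
  qed
  have "var_norm p f < ennreal (4 * \<kappa>)" using \<kappa> by (simp add: ennreal_less_iff)
  then obtain l where l: "0 < l" "ennreal l < ennreal (4 * \<kappa>)"
      "(\<integral>\<^sup>+x. epowr (f x / ennreal l) (p x) \<partial>lebesgue) \<le> 1"
    by (rule var_norm_lessE)
  have "epowr (f x / ennreal \<kappa>) (p x) \<le> ennreal (4 powr P) * epowr (f x / ennreal l) (p x)" for x
  proof -
    have "1 / \<kappa> \<le> 4 * (1 / l)" using l \<kappa>(1) by (simp add: ennreal_less_iff field_simps)
    then have "ennreal (1 / \<kappa>) * f x \<le> ennreal (4 * (1 / l)) * f x"
      by (intro mult_right_mono ennreal_leI) auto
    also have "\<dots> = ennreal 4 * (f x / ennreal l)"
      using l(1) by (simp add: divide_ennreal_eq_mult mult.assoc[symmetric] ennreal_mult'[symmetric]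
          del: ennreal_numeral)
    finally have "epowr (f x / ennreal \<kappa>) (p x) \<le> epowr (ennreal 4 * (f x / ennreal l)) (p x)"
      using p \<kappa>(1) by (intro epowr_mono) (auto simp: divide_ennreal_eq_mult)
    also have "\<dots> = ennreal (4 powr p x) * epowr (f x / ennreal l) (p x)"
      using p by (simp add: epowr_mult del: ennreal_numeral)
    also have "\<dots> \<le> ennreal (4 powr P) * epowr (f x / ennreal l) (p x)"
      using p by (intro mult_right_mono ennreal_leI powr_mono) auto
    finally show ?thesis .
  qed
  then have "(\<integral>\<^sup>+x. epowr (f x / ennreal \<kappa>) (p x) \<partial>lebesgue)
      \<le> (\<integral>\<^sup>+x. ennreal (4 powr P) * epowr (f x / ennreal l) (p x) \<partial>lebesgue)"
    by (rule nn_integral_mono)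
  also have "\<dots> = ennreal (4 powr P) * (\<integral>\<^sup>+x. epowr (f x / ennreal l) (p x) \<partial>lebesgue)"
    by (intro nn_integral_cmult) measurable
  also have "\<dots> \<le> ennreal (4 powr P) * 1" by (intro mult_left_mono l) simp
  finally show "(\<integral>\<^sup>+x. epowr (f x / ennreal \<kappa>) (p x) \<partial>lebesgue) \<le> ennreal (4 powr P)" by simp
qed

text \<open>Duality: \<open>\<phi>^(qv - q)\<close> turns the modular of \<open>\<phi>\<close> into a pairing with \<open>\<phi>^q\<close>, and its own modular
  for the conjugate exponent of \<open>qv / q\<close> is that of \<open>\<phi>\<close>. A truncation makes it bounded.\<close>

lemma dual_function:
  fixes qv r :: "'a::euclidean_space \<Rightarrow> real"
  assumes [measurable]: "\<phi> \<in> borel_measurable lebesgue" "qv \<in> borel_measurable lebesgue"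
    and q: "0 < q" "\<And>x. q < qv x" and r: "\<And>x. 1 \<le> r x" "\<And>x. q / qv x + 1 / r x = 1"
    and \<phi>: "1 < (\<integral>\<^sup>+x. epowr (\<phi> x) (qv x) \<partial>lebesgue)" "(\<integral>\<^sup>+x. epowr (\<phi> x) (qv x) \<partial>lebesgue) \<le> ennreal D"
    and D: "1 \<le> D"
  obtains h N where "h \<in> borel_measurable lebesgue" "0 \<le> N" "\<And>x. h x \<le> ennreal N"
    "(\<integral>\<^sup>+x. epowr (h x) (r x) \<partial>lebesgue) \<le> 1"
    "ennreal (1 / D) \<le> (\<integral>\<^sup>+x. epowr (\<phi> x) q * h x \<partial>lebesgue)"
proof -
  define h0 where "h0 x = epowr (\<phi> x) (qv x - q)" for x
  have [measurable]: "h0 \<in> borel_measurable lebesgue" unfolding h0_def by measurable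
  define hN where "hN N x = min (h0 x) (of_nat N)" for N :: nat and x
  have [measurable]: "hN N \<in> borel_measurable lebesgue" for N unfolding hN_def by measurable
  have h0: "h0 x = (SUP N. hN N x)" for x
  proof -
    have "(SUP N. hN N x) = inf (h0 x) (SUP N. of_nat N)"
      unfolding hN_def inf_min[symmetric] by (rule inf_SUP[symmetric])
    then show ?thesis by (simp add: ennreal_SUP_of_nat_eq_top)
  qed
  have "(\<integral>\<^sup>+x. epowr (\<phi> x) (qv x) \<partial>lebesgue) = (\<integral>\<^sup>+x. (SUP N. epowr (\<phi> x) q * hN N x) \<partial>lebesgue)"
  proof (rule nn_integral_cong)
    fix x
    have "epowr (\<phi> x) (qv x) = epowr (\<phi> x) q * h0 x" by (simp add: h0_def epowr_add)
    also have "\<dots> = (SUP N. epowr (\<phi> x) q * hN N x)"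
      unfolding h0 by (simp add: SUP_mult_left_ennreal)
    finally show "epowr (\<phi> x) (qv x) = (SUP N. epowr (\<phi> x) q * hN N x)" .
  qed
  also have "\<dots> = (SUP N. \<integral>\<^sup>+x. epowr (\<phi> x) q * hN N x \<partial>lebesgue)"
    by (intro nn_integral_monotone_convergence_SUP)
      (auto simp: incseq_def le_fun_def hN_def intro!: mult_left_mono min.mono)
  finally obtain N where N: "1 < (\<integral>\<^sup>+x. epowr (\<phi> x) q * hN N x \<partial>lebesgue)"
    using \<phi>(1) by (auto simp: less_SUP_iff)
  show ?thesis
  proof
    show "(\<lambda>x. ennreal (1 / D) * hN N x) \<in> borel_measurable lebesgue" by measurable
    show "0 \<le> real N" by simp
    show "ennreal (1 / D) * hN N x \<le> ennreal (real N)" for x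
    proof -
      have "ennreal (1 / D) * hN N x \<le> 1 * of_nat N"
        using D by (intro mult_mono) (auto simp: hN_def)
      then show ?thesis by (simp add: ennreal_of_nat_eq_real_of_nat)
    qed
    have "epowr (ennreal (1 / D) * hN N x) (r x) \<le> ennreal (1 / D) * epowr (\<phi> x) (qv x)" for x
    proof -
      have r0: "0 < r x" using r(1)[of x] by linarith
      have "epowr (hN N x) (r x) \<le> epowr (h0 x) (r x)"
        using r0 by (intro epowr_mono) (auto simp: hN_def)
      also have "(qv x - q) * r x = qv x"
      proof -
        have "q * r x + qv x = qv x * r x"
          using r(2)[of x] r0 q(1) q(2)[of x] by (simp add: field_simps)
        then show ?thesis by (simp add: algebra_simps)
      qed
      then have "epowr (h0 x) (r x) = epowr (\<phi> x) (qv x)" by (simp add: h0_def epowr_epowr)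
      finally have "epowr (hN N x) (r x) \<le> epowr (\<phi> x) (qv x)" .
      moreover have "(1 / D) powr r x \<le> (1 / D) powr 1" using D r(1) by (intro powr_mono') auto
      then have "epowr (ennreal (1 / D)) (r x) \<le> ennreal (1 / D)" using D by (simp add: ennreal_leI)
      ultimately show ?thesis unfolding epowr_mult[OF r0] by (intro mult_mono) auto
    qed
    then have "(\<integral>\<^sup>+x. epowr (ennreal (1 / D) * hN N x) (r x) \<partial>lebesgue)
        \<le> (\<integral>\<^sup>+x. ennreal (1 / D) * epowr (\<phi> x) (qv x) \<partial>lebesgue)"
      by (rule nn_integral_mono)
    also have "\<dots> = ennreal (1 / D) * (\<integral>\<^sup>+x. epowr (\<phi> x) (qv x) \<partial>lebesgue)"
      by (intro nn_integral_cmult) measurable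
    also have "\<dots> \<le> ennreal (1 / D) * ennreal D" by (intro mult_left_mono \<phi>) simp
    also have "\<dots> = 1" using D by (simp add: ennreal_mult'[symmetric])
    finally show "(\<integral>\<^sup>+x. epowr (ennreal (1 / D) * hN N x) (r x) \<partial>lebesgue) \<le> 1" .
    have "ennreal (1 / D) * 1 \<le> ennreal (1 / D) * (\<integral>\<^sup>+x. epowr (\<phi> x) q * hN N x \<partial>lebesgue)"
      using N by (intro mult_left_mono) auto
    also have "\<dots> = (\<integral>\<^sup>+x. epowr (\<phi> x) q * (ennreal (1 / D) * hN N x) \<partial>lebesgue)"
      by (subst nn_integral_cmult[symmetric]) (auto simp: mult_ac)
    finally show "ennreal (1 / D) \<le> (\<integral>\<^sup>+x. epowr (\<phi> x) q * (ennreal (1 / D) * hN N x) \<partial>lebesgue)"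
      by simp
  qed
qed

lemma pairing_le:
  fixes s t :: "'a \<Rightarrow> real"
  assumes [measurable]: "u \<in> borel_measurable M" "v \<in> borel_measurable M" "s \<in> borel_measurable M"
      "t \<in> borel_measurable M"
    and "\<And>x. 1 < s x" "\<And>x. 1 / s x + 1 / t x = 1"
  shows "(\<integral>\<^sup>+x. u x * v x \<partial>M) \<le> (\<integral>\<^sup>+x. epowr (u x) (s x) \<partial>M) + (\<integral>\<^sup>+x. epowr (v x) (t x) \<partial>M)"
proof -
  have "(\<integral>\<^sup>+x. u x * v x \<partial>M) \<le> (\<integral>\<^sup>+x. epowr (u x) (s x) + epowr (v x) (t x) \<partial>M)"
    using assms by (intro nn_integral_mono mult_le_epowr_conjugate) auto
  also have "\<dots> = (\<integral>\<^sup>+x. epowr (u x) (s x) \<partial>M) + (\<integral>\<^sup>+x. epowr (v x) (t x) \<partial>M)"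
    by (intro nn_integral_add) measurable
  finally show ?thesis .
qed

lemma nn_integral_epowr_scale:
  assumes [measurable]: "f \<in> borel_measurable M" "w \<in> borel_measurable M" and "0 < l" "0 < a"
  shows "(\<integral>\<^sup>+x. epowr (f x) a * w x \<partial>M) = ennreal (l powr a) * (\<integral>\<^sup>+x. epowr (f x / ennreal l) a * w x \<partial>M)"
proof -
  have "epowr (f x) a = ennreal (l powr a) * epowr (f x / ennreal l) a" for x
  proof -
    have "f x = ennreal l * (f x / ennreal l)"
      using assms(3) by (simp add: divide_ennreal_eq_mult mult.assoc[symmetric] ennreal_mult'[symmetric])
    then have "epowr (f x) a = epowr (ennreal l * (f x / ennreal l)) a" by simp
    also have "\<dots> = ennreal (l powr a) * epowr (f x / ennreal l) a"
      using assms by (simp add: epowr_mult)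
    finally show ?thesis .
  qed
  then show ?thesis by (subst nn_integral_cmult[symmetric]) (auto simp: mult.assoc)
qed

section \<open>Extrapolation\<close>

lemma weight_of_bounded:
  fixes w :: "'a::euclidean_space \<Rightarrow> ennreal"
  assumes [measurable]: "w \<in> borel_measurable lebesgue" and "\<And>x. 0 < w x" "\<And>x. w x \<le> ennreal N"
  shows "weight w"
  unfolding weight_def
proof (intro conjI allI impI)
  show "AE x in lebesgue. 0 < w x \<and> w x < \<infinity>"
    using assms(2,3) by (intro AE_I2) (auto intro: le_less_trans[of _ "ennreal N"])
  fix K :: "'a set" assume K: "compact K"
  have "(\<integral>\<^sup>+x\<in>K. w x \<partial>lebesgue) \<le> (\<integral>\<^sup>+x. ennreal N * indicator K x \<partial>lebesgue)"
    by (intro nn_integral_mono mult_right_mono assms(3)) simp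
  also have "\<dots> = ennreal N * emeasure lebesgue K"
    using K by (intro nn_integral_cmult_indicator) (auto intro: lmeasurable_compact fmeasurableD)
  also have "\<dots> < \<infinity>"
    using emeasure_bounded_finite[OF compact_imp_bounded[OF K]] K
    by (auto simp: ennreal_mult_less_top compact_imp_closed)
  finally show "(\<integral>\<^sup>+x\<in>K. w x \<partial>lebesgue) < \<infinity>" .
qed fact

text \<open>The relation between the four exponents says that \<open>r * q / p\<close> is conjugate to \<open>pv / p\<close>, so
  that one and the same majorant \<open>H\<close> serves on both sides of the weighted inequality: up to constants,
  it is \<open>w^q\<close> and is dual to \<open>f^q\<close>, while its power \<open>H^(p/q)\<close> is \<open>w^p\<close> and is dual to \<open>g^p\<close>.\<close>

lemma extrapolation:
  fixes p q :: real and pv qv r :: "'a::euclidean_space \<Rightarrow> real"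
  assumes pq: "0 < p" "p < q"
    and F: "\<forall>(f, g)\<in>F. f \<in> borel_measurable lebesgue \<and> g \<in> borel_measurable lebesgue"
    and \<Phi>: "\<And>t. 0 < \<Phi> t" "\<And>w. weight w \<Longrightarrow> (\<lambda>x. epowr (w x) p) \<in> RH (q / p) \<Longrightarrow>
              family_ineq (Lp_norm q (\<lambda>x. epowr (w x) q)) (Lp_norm p (\<lambda>x. epowr (w x) p))
                (\<Phi> (RH_const (q / p) (\<lambda>x. epowr (w x) p))) F"
    and [measurable]: "pv \<in> borel_measurable lebesgue" "qv \<in> borel_measurable lebesgue"
      "r \<in> borel_measurable lebesgue"
    and pv: "\<And>x. p < pv x" and qv: "\<And>x. q < qv x" "\<And>x. qv x \<le> Q"
    and r: "r \<in> LH" "1 < \<rho>" "\<And>x. \<rho> \<le> r x" "\<And>x. r x \<le> R"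
    and conj_q: "\<And>x. q / qv x + 1 / r x = 1" and conj_p: "\<And>x. p / pv x + p / (q * r x) = 1"
  shows "\<exists>C>0. family_ineq (var_norm qv) (var_norm pv) C F"
proof -
  have q0: "0 < q" using pq by linarith
  have qp: "1 < q / p" using pq by simp
  have qv0: "0 < qv x" and r1: "1 \<le> r x" for x
    using qv(1)[of x] q0 r(2) r(3)[of x] by linarith+
  have Q: "0 < Q" using qv0[of undefined] qv(2)[of undefined] by linarith
  obtain K D where K: "1 \<le> K" and D: "1 \<le> D"
    and majorant: "\<And>h N. h \<in> borel_measurable lebesgue \<Longrightarrow> \<not> (AE x in lebesgue. h x = 0) \<Longrightarrow>
      (\<integral>\<^sup>+x. epowr (h x) (r x) \<partial>lebesgue) \<le> 1 \<Longrightarrow> (\<And>x. h x \<le> ennreal N) \<Longrightarrow> 0 \<le> N \<Longrightarrow>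
      \<exists>H. bounded_A1 K H \<and> (\<forall>x. h x \<le> H x) \<and> (\<integral>\<^sup>+x. epowr (H x) (r x) \<partial>lebesgue) \<le> ennreal D"
    using A1_majorant[OF r \<open>r \<in> borel_measurable lebesgue\<close>] by blast
  obtain y \<Lambda> where \<Lambda>: "1 \<le> \<Lambda>"
    and weights: "\<forall>H :: 'a \<Rightarrow> ennreal. bounded_A1 K H \<longrightarrow>
      (\<exists>v C. v \<in> borel_measurable lebesgue \<and> (\<forall>x. epowr (H x) (1 / (q / p)) \<le> v x) \<and>
        (\<forall>x. v x \<le> ennreal \<Lambda> * epowr (H x) (1 / (q / p))) \<and> RH_bound (q / p) v C \<and> RH_const (q / p) v = y)"
    by (rule A1_comparable_RH_const_eq[OF qp K, where 'a='a]) (rule that, assumption+)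
  define D0 where "D0 = 4 powr Q"
  have D0: "1 \<le> D0" using Q by (simp add: D0_def ge_one_powr_ge_zero)
  define C where "C = D0 powr (1 / q) * \<Phi> y * (\<Lambda> * (1 + D)) powr (1 / p)"
  have C: "0 < C" using D0 \<Phi>(1) \<Lambda> D by (simp add: C_def)
  have main: "ennreal \<kappa> \<le> ennreal C * ennreal \<mu>"
    if fg: "(f, g) \<in> F" and \<kappa>: "0 < \<kappa>" "var_norm qv f = ennreal (2 * \<kappa>)"
      and \<mu>: "0 < \<mu>" "(\<integral>\<^sup>+x. epowr (g x / ennreal \<mu>) (pv x) \<partial>lebesgue) \<le> 1" for f g \<kappa> \<mu>
  proof -
    have [measurable]: "f \<in> borel_measurable lebesgue" "g \<in> borel_measurable lebesgue"
      using F fg by auto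
    define \<phi> where "\<phi> = (\<lambda>x. f x / ennreal \<kappa>)"
    define \<gamma> where "\<gamma> = (\<lambda>x. g x / ennreal \<mu>)"
    have [measurable]: "\<phi> \<in> borel_measurable lebesgue" "\<gamma> \<in> borel_measurable lebesgue"
      unfolding \<phi>_def \<gamma>_def by measurable
    have \<phi>: "1 < (\<integral>\<^sup>+x. epowr (\<phi> x) (qv x) \<partial>lebesgue)" "(\<integral>\<^sup>+x. epowr (\<phi> x) (qv x) \<partial>lebesgue) \<le> ennreal D0"
      unfolding \<phi>_def D0_def using modular_half_norm[OF \<kappa> qv0 qv(2)] by simp_all
    obtain h N where [measurable]: "h \<in> borel_measurable lebesgue" and N: "0 \<le> N" "\<And>x. h x \<le> ennreal N"
      and h: "(\<integral>\<^sup>+x. epowr (h x) (r x) \<partial>lebesgue) \<le> 1"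
        "ennreal (1 / D0) \<le> (\<integral>\<^sup>+x. epowr (\<phi> x) q * h x \<partial>lebesgue)"
      by (rule dual_function[OF \<open>\<phi> \<in> borel_measurable lebesgue\<close> \<open>qv \<in> borel_measurable lebesgue\<close>
            q0 qv(1) r1 conj_q \<phi> D0]) blast
    have nz: "\<not> (AE x in lebesgue. h x = 0)"
    proof
      assume "AE x in lebesgue. h x = 0"
      then have "(\<integral>\<^sup>+x. epowr (\<phi> x) q * h x \<partial>lebesgue) = (\<integral>\<^sup>+x. 0 \<partial>(lebesgue :: 'a measure))"
        by (intro nn_integral_cong_AE) (elim eventually_mono, simp)
      with h(2) D0 show False by simp
    qed
    obtain H where H: "bounded_A1 K H" and hH: "\<And>x. h x \<le> H x"
      and HD: "(\<integral>\<^sup>+x. epowr (H x) (r x) \<partial>lebesgue) \<le> ennreal D"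
      using majorant[OF \<open>h \<in> borel_measurable lebesgue\<close> nz h(1) N(2,1)] by blast
    then obtain N' where [measurable]: "H \<in> borel_measurable lebesgue"
      and H0: "\<And>x. 0 < H x" and HN: "\<And>x. H x \<le> ennreal N'"
      unfolding bounded_A1_def by blast
    obtain v B where [measurable]: "v \<in> borel_measurable lebesgue"
      and v: "\<And>x. epowr (H x) (p / q) \<le> v x" "\<And>x. v x \<le> ennreal \<Lambda> * epowr (H x) (p / q)"
      and B: "RH_bound (q / p) v B" "RH_const (q / p) v = y"
      using weights H by auto
    \<comment> \<open>Both sides of the inequality for \<open>w\<close> are comparable with the pairings with \<open>H\<close> and \<open>H^(p/q)\<close>.\<close>
    define w where "w x = epowr (v x) (1 / p)" for x
    have [measurable]: "w \<in> borel_measurable lebesgue" unfolding w_def by measurable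
    have wp: "(\<lambda>x. epowr (w x) p) = v" using pq by (simp add: w_def)
    have wq: "epowr (w x) q = epowr (v x) (q / p)" for x by (simp add: w_def epowr_epowr)
    have v_pos: "0 < v x" for x
      using v(1)[of x] H0[of x] by (metis epowr_eq_0_iff le_zero_eq zero_less_iff_neq_zero)
    define W where "W = \<Lambda> * (max 0 N') powr (p / q)"
    have v_bounded: "v x \<le> ennreal W" for x
    proof -
      have "H x \<le> ennreal (max 0 N')" by (rule order.trans[OF HN]) (simp add: ennreal_leI)
      then have "v x \<le> ennreal \<Lambda> * epowr (ennreal (max 0 N')) (p / q)"
        using pq by (intro order.trans[OF v(2)] mult_left_mono epowr_mono) auto
      then show ?thesis using \<Lambda> by (simp add: W_def ennreal_mult)
    qed
    have "weight v" using v_pos v_bounded by (intro weight_of_bounded) auto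
    then have "v \<in> RH (q / p)" using B(1) by (auto simp: RH_def)
    moreover have "weight w"
    proof (rule weight_of_bounded)
      show "0 < w x" for x using v_pos[of x] by (simp add: w_def zero_less_iff_neq_zero)
      show "w x \<le> ennreal (W powr (1 / p))" for x
        using epowr_mono[OF _ v_bounded, of "1 / p" x] pq \<Lambda> by (simp add: w_def W_def)
    qed fact
    ultimately have ineq: "family_ineq (Lp_norm q (\<lambda>x. epowr (w x) q)) (Lp_norm p v) (\<Phi> y) F"
      using \<Phi>(2)[of w] unfolding wp B(2) by blast
    have H_wq: "H x \<le> epowr (w x) q" for x
    proof -
      have "epowr (epowr (H x) (p / q)) (q / p) \<le> epowr (v x) (q / p)"
        using pq v(1) by (intro epowr_mono) auto
      then show ?thesis using pq q0 by (simp add: wq epowr_epowr)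
    qed
    have wq_H: "epowr (w x) q \<le> ennreal (\<Lambda> powr (q / p)) * H x" for x
    proof -
      have "epowr (v x) (q / p) \<le> epowr (ennreal \<Lambda> * epowr (H x) (p / q)) (q / p)"
        using pq v(2) by (intro epowr_mono) auto
      then show ?thesis using pq q0 \<Lambda> by (simp add: wq epowr_mult epowr_epowr)
    qed
    \<comment> \<open>Finiteness of the left-hand side, without which the weighted inequality says nothing.\<close>
    have "Lp_norm q (\<lambda>x. epowr (w x) q) f < \<infinity>"
    proof -
      have "(\<integral>\<^sup>+x. epowr (\<phi> x) q * H x \<partial>lebesgue)
          \<le> (\<integral>\<^sup>+x. epowr (epowr (\<phi> x) q) (qv x / q) \<partial>lebesgue) + (\<integral>\<^sup>+x. epowr (H x) (r x) \<partial>lebesgue)"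
        using q0 qv(1) conj_q by (intro pairing_le) auto
      also have "\<dots> \<le> ennreal D0 + ennreal D"
        using q0 \<phi> HD by (intro add_mono) (auto simp: epowr_epowr)
      finally have fin: "(\<integral>\<^sup>+x. epowr (\<phi> x) q * H x \<partial>lebesgue) < top"
        by (rule le_less_trans) simp
      have "(\<integral>\<^sup>+x. epowr (f x) q * epowr (w x) q \<partial>lebesgue)
          = ennreal (\<kappa> powr q) * (\<integral>\<^sup>+x. epowr (\<phi> x) q * epowr (w x) q \<partial>lebesgue)"
        unfolding \<phi>_def using \<kappa> q0 by (intro nn_integral_epowr_scale) auto
      also have "\<dots> \<le> ennreal (\<kappa> powr q) *
          (\<integral>\<^sup>+x. ennreal (\<Lambda> powr (q / p)) * (epowr (\<phi> x) q * H x) \<partial>lebesgue)"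
      proof (intro mult_left_mono nn_integral_mono)
        fix x
        have "epowr (\<phi> x) q * epowr (w x) q \<le> epowr (\<phi> x) q * (ennreal (\<Lambda> powr (q / p)) * H x)"
          by (rule mult_left_mono[OF wq_H]) simp
        then show "epowr (\<phi> x) q * epowr (w x) q \<le> ennreal (\<Lambda> powr (q / p)) * (epowr (\<phi> x) q * H x)"
          by (simp only: mult_ac)
      qed simp
      also have "\<dots> = ennreal (\<kappa> powr q) * (ennreal (\<Lambda> powr (q / p)) * (\<integral>\<^sup>+x. epowr (\<phi> x) q * H x \<partial>lebesgue))"
        by (subst nn_integral_cmult) auto
      also have "\<dots> < top" using fin by (simp add: ennreal_mult_less_top)
      finally show ?thesis by (simp add: Lp_norm_def)
    qed
    then have weighted: "Lp_norm q (\<lambda>x. epowr (w x) q) f \<le> ennreal (\<Phi> y) * Lp_norm p v g"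
      using ineq fg by (auto simp: family_ineq_def)
    have lower: "ennreal (\<kappa> * D0 powr (- 1 / q)) \<le> Lp_norm q (\<lambda>x. epowr (w x) q) f"
    proof -
      have "ennreal (\<kappa> powr q * (1 / D0)) \<le> ennreal (\<kappa> powr q) * (\<integral>\<^sup>+x. epowr (\<phi> x) q * h x \<partial>lebesgue)"
        unfolding ennreal_mult'[OF powr_ge_zero] by (rule mult_left_mono[OF h(2)]) simp
      also have "\<dots> = (\<integral>\<^sup>+x. epowr (f x) q * h x \<partial>lebesgue)"
        unfolding \<phi>_def using \<kappa> q0 by (intro nn_integral_epowr_scale[symmetric]) auto
      also have "\<dots> \<le> (\<integral>\<^sup>+x. epowr (f x) q * epowr (w x) q \<partial>lebesgue)"
        by (intro nn_integral_mono mult_left_mono order.trans[OF hH H_wq]) simp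
      finally have "epowr (ennreal (\<kappa> powr q * (1 / D0))) (1 / q)
          \<le> epowr (\<integral>\<^sup>+x. epowr (f x) q * epowr (w x) q \<partial>lebesgue) (1 / q)"
        using q0 by (intro epowr_mono) auto
      moreover have "(\<kappa> powr q * (1 / D0)) powr (1 / q) = \<kappa> * D0 powr (- 1 / q)"
        using q0 \<kappa> D0 by (simp add: powr_mult powr_divide powr_powr powr_minus_divide)
      ultimately show ?thesis using D0 by (simp add: Lp_norm_def)
    qed
    have upper: "Lp_norm p v g \<le> ennreal (\<mu> * (\<Lambda> * (1 + D)) powr (1 / p))"
    proof -
      have "(\<integral>\<^sup>+x. epowr (\<gamma> x) p * epowr (H x) (p / q) \<partial>lebesgue)
          \<le> (\<integral>\<^sup>+x. epowr (epowr (\<gamma> x) p) (pv x / p) \<partial>lebesgue)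
            + (\<integral>\<^sup>+x. epowr (epowr (H x) (p / q)) (q * r x / p) \<partial>lebesgue)"
        using pq pv conj_p by (intro pairing_le) auto
      also have "\<dots> \<le> 1 + ennreal D"
        using pq q0 \<mu>(2) HD by (intro add_mono) (auto simp: epowr_epowr \<gamma>_def)
      also have "\<dots> = ennreal (1 + D)" using D by (simp add: ennreal_plus)
      finally have pair: "(\<integral>\<^sup>+x. epowr (\<gamma> x) p * epowr (H x) (p / q) \<partial>lebesgue) \<le> ennreal (1 + D)" .
      have "(\<integral>\<^sup>+x. epowr (g x) p * v x \<partial>lebesgue) = ennreal (\<mu> powr p) * (\<integral>\<^sup>+x. epowr (\<gamma> x) p * v x \<partial>lebesgue)"
        unfolding \<gamma>_def using \<mu> pq by (intro nn_integral_epowr_scale) auto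
      also have "\<dots> \<le> ennreal (\<mu> powr p) *
          (\<integral>\<^sup>+x. ennreal \<Lambda> * (epowr (\<gamma> x) p * epowr (H x) (p / q)) \<partial>lebesgue)"
      proof (intro mult_left_mono nn_integral_mono)
        fix x
        have "epowr (\<gamma> x) p * v x \<le> epowr (\<gamma> x) p * (ennreal \<Lambda> * epowr (H x) (p / q))"
          by (rule mult_left_mono[OF v(2)]) simp
        then show "epowr (\<gamma> x) p * v x \<le> ennreal \<Lambda> * (epowr (\<gamma> x) p * epowr (H x) (p / q))"
          by (simp only: mult_ac)
      qed simp
      also have "\<dots> = ennreal (\<mu> powr p) * (ennreal \<Lambda> * (\<integral>\<^sup>+x. epowr (\<gamma> x) p * epowr (H x) (p / q) \<partial>lebesgue))"
        by (subst nn_integral_cmult) auto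
      also have "\<dots> \<le> ennreal (\<mu> powr p) * (ennreal \<Lambda> * ennreal (1 + D))"
        by (intro mult_left_mono pair) auto
      also have "\<dots> = ennreal (\<mu> powr p * (\<Lambda> * (1 + D)))"
        using \<Lambda> D by (simp add: ennreal_mult'[symmetric] del: ennreal_plus)
      finally have "Lp_norm p v g \<le> epowr (ennreal (\<mu> powr p * (\<Lambda> * (1 + D)))) (1 / p)"
        unfolding Lp_norm_def using pq by (intro epowr_mono) auto
      moreover have "(\<mu> powr p * (\<Lambda> * (1 + D))) powr (1 / p) = \<mu> * (\<Lambda> * (1 + D)) powr (1 / p)"
        using pq \<mu> \<Lambda> D by (subst powr_mult) (auto simp: powr_powr)
      ultimately show ?thesis using \<Lambda> D by simp
    qed
    have "ennreal (\<kappa> * D0 powr (- 1 / q)) \<le> ennreal (\<Phi> y) * ennreal (\<mu> * (\<Lambda> * (1 + D)) powr (1 / p))"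
      by (rule order.trans[OF lower order.trans[OF weighted mult_left_mono[OF upper]]]) simp
    then have "\<kappa> * D0 powr (- 1 / q) \<le> \<Phi> y * (\<mu> * (\<Lambda> * (1 + D)) powr (1 / p))"
      using \<Phi>(1)[of y] \<mu>(1) by (simp add: ennreal_mult'[symmetric] less_imp_le ennreal_le_iff)
    then have "D0 powr (1 / q) * (\<kappa> * D0 powr (- 1 / q))
        \<le> D0 powr (1 / q) * (\<Phi> y * (\<mu> * (\<Lambda> * (1 + D)) powr (1 / p)))"
      by (rule mult_left_mono) simp
    moreover have "D0 powr (1 / q) * (\<kappa> * D0 powr (- 1 / q)) = \<kappa>"
      using D0 by (simp add: powr_minus_divide)
    moreover have "D0 powr (1 / q) * (\<Phi> y * (\<mu> * (\<Lambda> * (1 + D)) powr (1 / p))) = C * \<mu>"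
      by (simp add: C_def mult_ac)
    ultimately have "\<kappa> \<le> C * \<mu>" by (simp only:)
    then show ?thesis using C \<mu>(1) by (simp add: ennreal_mult[symmetric] ennreal_leI less_imp_le)
  qed
  have "var_norm qv f \<le> ennreal (2 * C) * var_norm pv g"
    if fg: "(f, g) \<in> F" and fin: "var_norm qv f < \<infinity>" for f g
  proof (cases "var_norm qv f = 0")
    case False
    obtain z where z: "var_norm qv f = ennreal z" "0 \<le> z" using fin by (cases "var_norm qv f") auto
    then have z0: "0 < z" using False by (auto simp: less_le)
    show ?thesis
    proof (rule le_mult_var_normI)
      show "0 < 2 * C" using C by simp
      fix \<mu> assume "0 < \<mu>" "(\<integral>\<^sup>+x. epowr (g x / ennreal \<mu>) (pv x) \<partial>lebesgue) \<le> 1"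
      then have "ennreal (z / 2) \<le> ennreal C * ennreal \<mu>"
        using main[OF fg, of "z / 2" \<mu>] z z0 by simp
      then have "z / 2 \<le> C * \<mu>"
        using C \<open>0 < \<mu>\<close> by (simp add: ennreal_mult[symmetric] less_imp_le ennreal_le_iff)
      then show "var_norm qv f \<le> ennreal (2 * C) * ennreal \<mu>"
        using C \<open>0 < \<mu>\<close> by (simp add: z(1) ennreal_mult[symmetric] less_imp_le ennreal_leI)
    qed
  qed simp
  then show ?thesis
    using C by (intro exI[of _ "2 * C"]) (auto simp: family_ineq_def)
qed

lemma conjugate_exponent_lipschitz:
  fixes p q a b :: real
  assumes pq: "0 < p" "0 < q" and a0: "0 < a" and pa: "p < a"
  shows "\<exists>L. L-lipschitz_on {a..b} (\<lambda>t. 1 / (q * (1 / p - 1 / t)))"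
proof -
  define \<psi> where "\<psi> t = 1 / (q * (1 / p - 1 / t))" for t :: real
  have ca: "1 / a < 1 / p" using pa a0 pq by (simp add: frac_less2)
  define L where "L = 1 / (q * (1 / p - 1 / a)^2 * a^2)"
  have "L-lipschitz_on {a..b} \<psi>"
  proof (rule lipschitz_onI)
    show "0 \<le> L" using pq by (simp add: L_def)
    fix s t assume st: "s \<in> {a..b}" "t \<in> {a..b}"
    have d: "0 < 1 / p - 1 / a" using ca by simp
    have e: "1 / p - 1 / a \<le> 1 / p - 1 / u" if "u \<in> {a..b}" for u
      using that a0 by (auto intro!: divide_left_mono)
    have pos: "0 < 1 / p - 1 / u" if "u \<in> {a..b}" for u using d e[OF that] by linarith
    have s0: "0 < s" and t0: "0 < t" using st a0 by auto
    have diff: "\<psi> s - \<psi> t = (t - s) / (q * ((1 / p - 1 / s) * (1 / p - 1 / t)) * (s * t))"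
    proof -
      have frac: "1 / (q * u) - 1 / (q * v) = (1 / q) * (v - u) / (u * v)" if "0 < u" "0 < v" for u v
        using that pq by (simp add: field_simps)
      have "\<psi> s - \<psi> t = (1 / q) * ((1 / p - 1 / t) - (1 / p - 1 / s)) / ((1 / p - 1 / s) * (1 / p - 1 / t))"
        unfolding \<psi>_def by (rule frac[OF pos[OF st(1)] pos[OF st(2)]])
      also have "(1 / p - 1 / t) - (1 / p - 1 / s) = (t - s) / (s * t)"
        using s0 t0 by (simp add: field_simps)
      finally show ?thesis by simp
    qed
    have "(1 / p - 1 / a)^2 \<le> (1 / p - 1 / s) * (1 / p - 1 / t)"
      unfolding power2_eq_square
      using d e[OF st(1)] e[OF st(2)] pos[OF st(1)] by (intro mult_mono) linarith+
    moreover have "a^2 \<le> s * t"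
      unfolding power2_eq_square using a0 st by (intro mult_mono) auto
    ultimately have "q * (1 / p - 1 / a)^2 * a^2 \<le> q * ((1 / p - 1 / s) * (1 / p - 1 / t)) * (s * t)"
      using pq mult_pos_pos[OF pos[OF st(1)] pos[OF st(2)]]
      by (intro mult_mono mult_left_mono mult_nonneg_nonneg[OF less_imp_le less_imp_le]) auto
    moreover have "0 < q * (1 / p - 1 / a)^2 * a^2"
      using pq(2) d a0 by (intro mult_pos_pos zero_less_power)
    ultimately have "\<bar>t - s\<bar> / (q * ((1 / p - 1 / s) * (1 / p - 1 / t)) * (s * t))
        \<le> \<bar>t - s\<bar> / (q * (1 / p - 1 / a)^2 * a^2)"
      by (intro divide_left_mono) auto
    moreover have "\<bar>\<psi> s - \<psi> t\<bar> = \<bar>t - s\<bar> / (q * ((1 / p - 1 / s) * (1 / p - 1 / t)) * (s * t))"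
      unfolding diff using pos[OF st(1)] pos[OF st(2)] pq s0 t0 by (simp add: abs_divide abs_mult)
    ultimately show "dist (\<psi> s) (\<psi> t) \<le> L * dist s t"
      by (simp add: dist_real_def L_def abs_minus_commute)
  qed
  then show ?thesis unfolding \<psi>_def[abs_def] ..
qed

theorem theorem3p4:
  fixes p q :: real
    and F :: "(('a::euclidean_space \<Rightarrow> ennreal) \<times> ('a \<Rightarrow> ennreal)) set"
  assumes "0 < p" and "p < q"
    and "\<forall>(f, g)\<in>F. f \<in> borel_measurable lebesgue \<and> g \<in> borel_measurable lebesgue"
    and "\<exists>\<Phi>::real \<Rightarrow> real. (\<forall>t. 0 < \<Phi> t) \<and>
           (\<forall>w. weight w \<and> (\<lambda>x. epowr (w x) p) \<in> RH (q / p) \<longrightarrow>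
              family_ineq (Lp_norm q (\<lambda>x. epowr (w x) q)) (Lp_norm p (\<lambda>x. epowr (w x) p))
                (\<Phi> (RH_const (q / p) (\<lambda>x. epowr (w x) p))) F)"
  shows "\<forall>pv qv :: 'a \<Rightarrow> real.
           pv \<in> P0 \<and> ereal p < exp_minus pv \<and> exp_minus pv \<le> exp_plus pv
             \<and> exp_plus pv < ereal (1 / (1 / p - 1 / q)) \<and> pv \<in> LH
             \<and> (\<forall>x. 1 / pv x - 1 / qv x = 1 / p - 1 / q) \<longrightarrow>
           (\<exists>C>0. family_ineq (var_norm qv) (var_norm pv) C F)"
proof (intro allI impI, elim conjE)
  fix pv qv :: "'a \<Rightarrow> real"
  assume "pv \<in> P0" and lo: "ereal p < exp_minus pv" and hi: "exp_plus pv < ereal (1 / (1 / p - 1 / q))"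
    and LH: "pv \<in> LH" and rel: "\<forall>x. 1 / pv x - 1 / qv x = 1 / p - 1 / q"
  have [measurable]: "pv \<in> borel_measurable lebesgue" using \<open>pv \<in> P0\<close> by (simp add: P0_def)
  obtain a b where ab: "p < a" "b < 1 / (1 / p - 1 / q)" and pv: "\<And>x. a \<le> pv x" "\<And>x. pv x \<le> b"
    using continuous_bounds_everywhere[OF LH_continuous[OF LH] lo hi] by blast
  define c where "c = 1 / p - 1 / q"
  have pq: "0 < p" "0 < q" using assms(1,2) by auto
  have c: "0 < c" using assms(1,2) by (simp add: c_def frac_less2)
  have a0: "0 < a" and b0: "0 < b" using pq ab pv[of undefined] by linarith+
  have pv0: "0 < pv x" for x using a0 pv(1)[of x] by linarith
  have inv_pv: "1 / b \<le> 1 / pv x" "1 / pv x \<le> 1 / a" for x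
    using pv[of x] pv0[of x] a0 by (auto intro!: divide_left_mono)
  have ca: "1 / a < 1 / p" and cb: "c < 1 / b"
    using ab pq a0 b0 c by (auto simp: c_def[symmetric] field_simps)
  have qv_eq: "1 / qv x = 1 / pv x - c" for x
    using rel[rule_format, of x] unfolding c_def by linarith
  have inv_qv: "1 / b - c \<le> 1 / qv x" "1 / qv x < 1 / q" for x
    using inv_pv[of x] ca by (auto simp: qv_eq c_def)
  have qv0: "0 < qv x" for x
    using inv_qv(1)[of x] cb by (metis diff_gt_0_iff_gt less_le_trans zero_less_divide_1_iff)
  have qv_gt: "q < qv x" for x using inv_qv(2)[of x] qv0[of x] pq by (simp add: field_simps)
  have qv_le: "qv x \<le> 1 / (1 / b - c)" for x
    using inv_qv(1)[of x] qv0[of x] cb by (simp add: field_simps)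
  have qv_expr: "qv = (\<lambda>x. 1 / (1 / pv x - c))"
    by (simp add: qv_eq[symmetric])
  have [measurable]: "qv \<in> borel_measurable lebesgue" unfolding qv_expr by measurable
  \<comment> \<open>The exponent conjugate to \<open>qv / q\<close>, as a function of \<open>pv\<close>. The lower bound of \<open>pv\<close> keeps it
    finite, and the upper bound keeps it above one.\<close>
  define \<psi> where "\<psi> t = 1 / (q * (1 / p - 1 / t))" for t :: real
  define r where "r x = \<psi> (pv x)" for x
  have [measurable]: "r \<in> borel_measurable lebesgue" unfolding r_def \<psi>_def by measurable
  have inv_r: "1 / r x = q * (1 / p - 1 / pv x)" for x by (simp add: r_def \<psi>_def)
  have "\<exists>L. L-lipschitz_on {a..b} \<psi>"
    unfolding \<psi>_def using pq a0 ab(1) by (rule conjugate_exponent_lipschitz)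
  then have r_LH: "r \<in> LH"
    unfolding r_def[abs_def] using LH_compose[OF LH pv] by blast
  define \<rho> where "\<rho> = 1 / (q * (1 / p - 1 / b))"
  define R where "R = 1 / (q * (1 / p - 1 / a))"
  have pb: "0 < 1 / p - 1 / b" "1 / p - 1 / b < 1 / q"
    using cb inv_pv[of undefined] ca by (auto simp: c_def)
  have r_bounds: "\<rho> \<le> r x" "r x \<le> R" for x
    unfolding r_def \<psi>_def \<rho>_def R_def using inv_pv[of x] ca pq
    by (auto intro!: divide_left_mono mult_pos_pos)
  have \<rho>: "1 < \<rho>"
  proof -
    have "q * (1 / p - 1 / b) < q * (1 / q)" by (rule mult_strict_left_mono[OF pb(2) pq(2)])
    moreover have "q * (1 / q) = 1" using pq by simp
    moreover have "0 < q * (1 / p - 1 / b)" by (rule mult_pos_pos[OF pq(2) pb(1)])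
    ultimately show ?thesis unfolding \<rho>_def by (simp only: less_divide_eq_1_pos)
  qed
  have conj_q: "q / qv x + 1 / r x = 1" for x
  proof -
    have "q / qv x = q * (1 / pv x - c)" unfolding qv_eq[symmetric] by simp
    then have "q / qv x + 1 / r x = q * (1 / pv x - c) + q * (1 / p - 1 / pv x)" by (simp only: inv_r)
    also have "\<dots> = q * (1 / q)" unfolding c_def by (simp only: distrib_left[symmetric]) simp
    finally show ?thesis using pq by simp
  qed
  have conj_p: "p / pv x + p / (q * r x) = 1" for x
  proof -
    have "p / (q * r x) = (p / q) * (1 / r x)" by simp
    also have "\<dots> = p * (1 / p - 1 / pv x)" unfolding inv_r using pq by simp
    also have "\<dots> = 1 - p / pv x" using pq by (simp add: right_diff_distrib)
    finally show ?thesis by simp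
  qed
  obtain \<Phi> :: "real \<Rightarrow> real" where \<Phi>: "\<And>t. 0 < \<Phi> t" "\<And>w. weight w \<Longrightarrow> (\<lambda>x. epowr (w x) p) \<in> RH (q / p) \<Longrightarrow>
      family_ineq (Lp_norm q (\<lambda>x. epowr (w x) q)) (Lp_norm p (\<lambda>x. epowr (w x) p))
        (\<Phi> (RH_const (q / p) (\<lambda>x. epowr (w x) p))) F"
    using assms(4) by blast
  have p_less: "p < pv x" for x using ab(1) pv(1)[of x] by linarith
  show "\<exists>C>0. family_ineq (var_norm qv) (var_norm pv) C F"
    by (rule extrapolation[of p q F \<Phi> pv qv r "1 / (1 / b - c)" \<rho> R])
      (use assms(1-3) \<Phi> p_less qv_gt qv_le r_LH \<rho> r_bounds conj_q conj_p in auto)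
qed

end
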